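(* There exists a maximal annulus $A\subset S(-1,1)$ with a planar end in $\mathbb{L}^3$ such that the boundary $\partial A$ consists of a circle and a strictly convex non-circular real analytic Jordan curve, lying in the two boundary planes $\Pi_1$ and $\Pi_{-1}$ of the slab respectively, and such that for some $t_0\in(-1,1)$ the intersection $A\cap\Pi_{t_0}$ is a non-convex Jordan curve.
   Context: $\mathbb{L}^3$ is $\mathbb{R}^3$ with the metric $dx_1^2+dx_2^2-dx_3^2$. $\Pi_t=\{x_3=t\}$, $S(a,b)=\{a\le x_3\le b\}$. An immersed surface is spacelike if all its tangent planes are spacelike; a spacelike surface is maximal if its mean curvature vanishes identically. Circles in horizontal planes are the usual Euclidean circles. A planar end is an embedded end $X:\mathcal D\setminus\{0\}\to\mathbb{L}^3$ of a maximal surface, conformally a punctured disk with coordinate $z=re^{i\theta}$, with vertical limit normal, which is asymptotic near $0$ to $(\alpha r^{-1}\cos\theta,\alpha r^{-1}\sin\theta,\beta\log r)$ with $\alpha\in\mathbb R\setminus\{0\}$ and $\beta=0$; thus it is asymptotic to a horizontal plane. A maximal annulus with a planar end in $S(-1,1)$ is a maximal surface whose underlying surface is an annulus punctured at one interior point, the puncture corresponding to a planar end, and whose two boundary components lie in $\Pi_1$ and $\Pi_{-1}$ respectively. *)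

theory Defs
  imports "HOL-Analysis.Analysis"
begin

text \<open>The underlying vector space of \<open>L\<^sup>3\<close> is \<^typ>\<open>real^3\<close>; the Lorentzian scalar
  product below is used for everything metric about surfaces, whereas topology, limits, and
  circles in horizontal planes refer to the Euclidean structure of \<^typ>\<open>real^3\<close>.\<close>

definition lorentz :: "real^3 \<Rightarrow> real^3 \<Rightarrow> real" where
  "lorentz x y = x$1 * y$1 + x$2 * y$2 - x$3 * y$3"

text \<open>The Lorentzian cross product, characterised by \<open>lorentz (lcross x y) w = det (x, y, w)\<close>.\<close>

definition lcross :: "real^3 \<Rightarrow> real^3 \<Rightarrow> real^3" where
  "lcross x y = vector [cross3 x y $ 1, cross3 x y $ 2, - (cross3 x y $ 3)]"

definition hplane :: "real \<Rightarrow> (real^3) set" where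
  "hplane t = {x. x$3 = t}"

definition slab :: "real \<Rightarrow> real \<Rightarrow> (real^3) set" where
  "slab a b = {x. a \<le> x$3 \<and> x$3 \<le> b}"

definition dder :: "complex \<Rightarrow> (complex \<Rightarrow> 'a::real_normed_vector) \<Rightarrow> complex \<Rightarrow> 'a" where
  "dder v f z = frechet_derivative f (at z) v"

text \<open>The following two notions are meant for open sets \<open>S\<close>. The directions \<open>1\<close> and \<open>\<i>\<close> are
  the two coordinate directions of the parameter plane.\<close>

fun Ck_on :: "nat \<Rightarrow> (complex \<Rightarrow> 'a::real_normed_vector) \<Rightarrow> complex set \<Rightarrow> bool" where
  "Ck_on 0 f S = continuous_on S f"
| "Ck_on (Suc k) f S =
    ((\<forall>z\<in>S. f differentiable (at z)) \<and> Ck_on k (dder 1 f) S \<and> Ck_on k (dder \<i> f) S)"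

definition Cinf_on :: "(complex \<Rightarrow> 'a::real_normed_vector) \<Rightarrow> complex set \<Rightarrow> bool" where
  "Cinf_on f S \<longleftrightarrow> (\<forall>k. Ck_on k f S)"

text \<open>The induced metric is positive definite at \<open>z\<close>; in particular \<open>X\<close> is an immersion at \<open>z\<close>.\<close>

definition spacelike_at :: "(complex \<Rightarrow> real^3) \<Rightarrow> complex \<Rightarrow> bool" where
  "spacelike_at X z \<longleftrightarrow> (\<forall>v. v \<noteq> 0 \<longrightarrow> 0 < lorentz (dder v X z) (dder v X z))"

definition unit_normal :: "(complex \<Rightarrow> real^3) \<Rightarrow> complex \<Rightarrow> real^3" where
  "unit_normal X z =
    (let n = lcross (dder 1 X z) (dder \<i> X z) in (1 / sqrt (- lorentz n n)) *\<^sub>R n)"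

text \<open>Up to the sign convention (the normal is timelike), half the trace of the second
  fundamental form with respect to the first one.\<close>

definition mean_curvature :: "(complex \<Rightarrow> real^3) \<Rightarrow> complex \<Rightarrow> real" where
  "mean_curvature X z =
    (let E = lorentz (dder 1 X z) (dder 1 X z);
         F = lorentz (dder 1 X z) (dder \<i> X z);
         G = lorentz (dder \<i> X z) (dder \<i> X z);
         N = unit_normal X z;
         e = lorentz (dder 1 (dder 1 X) z) N;
         f = lorentz (dder 1 (dder \<i> X) z) N;
         g = lorentz (dder \<i> (dder \<i> X) z) N
     in (e * G - 2 * f * F + g * E) / (2 * (E * G - F\<^sup>2)))"

text \<open>\<open>K\<close> may have boundary points: smoothness on \<open>K\<close> means smoothness on an open
  neighbourhood of \<open>K\<close>.\<close>

definition maximal_surface :: "(complex \<Rightarrow> real^3) \<Rightarrow> complex set \<Rightarrow> bool" where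
  "maximal_surface X K \<longleftrightarrow>
    (\<exists>U. open U \<and> K \<subseteq> U \<and> Cinf_on X U) \<and>
    (\<forall>z\<in>K. spacelike_at X z \<and> mean_curvature X z = 0)"

definition conformal_on :: "(complex \<Rightarrow> real^3) \<Rightarrow> complex set \<Rightarrow> bool" where
  "conformal_on Y S \<longleftrightarrow>
    (\<forall>z\<in>S. lorentz (dder 1 Y z) (dder 1 Y z) = lorentz (dder \<i> Y z) (dder \<i> Y z) \<and>
           lorentz (dder 1 Y z) (dder \<i> Y z) = 0)"

definition end_model :: "real \<Rightarrow> real \<Rightarrow> complex \<Rightarrow> real^3" where
  "end_model \<alpha> \<beta> z =
    vector [\<alpha> * cos (Arg z) / norm z, \<alpha> * sin (Arg z) / norm z, \<beta> * ln (norm z)]"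

text \<open>\<open>Y\<close> is a planar end on the punctured unit disk. It is asymptotic to the model with
  \<open>\<beta> = 0\<close> up to a translation by \<open>c\<close>, hence to the horizontal plane at height \<open>c$3\<close>.\<close>

definition planar_end :: "(complex \<Rightarrow> real^3) \<Rightarrow> bool" where
  "planar_end Y \<longleftrightarrow>
    maximal_surface Y (ball 0 1 - {0}) \<and>
    inj_on Y (ball 0 1 - {0}) \<and>
    conformal_on Y (ball 0 1 - {0}) \<and>
    ((unit_normal Y \<longlongrightarrow> axis 3 1) (at 0) \<or> (unit_normal Y \<longlongrightarrow> - axis 3 1) (at 0)) \<and>
    (\<exists>\<alpha> c. \<alpha> \<noteq> 0 \<and> ((\<lambda>z. Y z - end_model \<alpha> 0 z) \<longlongrightarrow> c) (at 0))"

text \<open>\<open>\<phi>\<close> is the change of coordinates from the conformal coordinate of the end, with the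
  puncture at \<open>0\<close>, to the given parameter domain, with the puncture at \<open>p\<close>.\<close>

definition has_planar_end_at ::
    "(complex \<Rightarrow> real^3) \<Rightarrow> complex set \<Rightarrow> complex \<Rightarrow> bool" where
  "has_planar_end_at X V p \<longleftrightarrow>
    (\<exists>\<phi>. \<phi> 0 = p \<and> continuous_on (ball 0 1) \<phi> \<and> inj_on \<phi> (ball 0 1) \<and>
         \<phi> ` ball 0 1 \<subseteq> V \<and>
         Cinf_on \<phi> (ball 0 1 - {0}) \<and>
         (\<forall>z\<in>ball 0 1 - {0}. \<forall>v. v \<noteq> 0 \<longrightarrow> dder v \<phi> z \<noteq> 0) \<and>
         planar_end (X \<circ> \<phi>))"

text \<open>Up to diffeomorphism, every annulus punctured at an interior point is of the form
  \<open>punctured_annulus r R p\<close> with \<open>0 < r < norm p < R\<close>. The parametrization is not required to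
  be conformal on the whole annulus.\<close>

definition punctured_annulus :: "real \<Rightarrow> real \<Rightarrow> complex \<Rightarrow> complex set" where
  "punctured_annulus r R p = {z. r \<le> norm z \<and> norm z \<le> R} - {p}"

definition maximal_annulus_planar_end ::
    "real \<Rightarrow> real \<Rightarrow> real \<Rightarrow> real \<Rightarrow> complex \<Rightarrow> (complex \<Rightarrow> real^3) \<Rightarrow> bool" where
  "maximal_annulus_planar_end a b r R p X \<longleftrightarrow>
    0 < r \<and> r < norm p \<and> norm p < R \<and>
    maximal_surface X (punctured_annulus r R p) \<and>
    has_planar_end_at X {z. r < norm z \<and> norm z < R} p \<and>
    X ` punctured_annulus r R p \<subseteq> slab a b \<and>
    (X ` sphere 0 r \<subseteq> hplane b \<and> X ` sphere 0 R \<subseteq> hplane a \<or>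
     X ` sphere 0 r \<subseteq> hplane a \<and> X ` sphere 0 R \<subseteq> hplane b)"

definition jordan_curve_in :: "real \<Rightarrow> (real^3) set \<Rightarrow> bool" where
  "jordan_curve_in t C \<longleftrightarrow> C \<subseteq> hplane t \<and>
    (\<exists>\<gamma>. simple_path \<gamma> \<and> pathfinish \<gamma> = pathstart \<gamma> \<and> path_image \<gamma> = C)"

definition real_analytic :: "(real \<Rightarrow> 'a::real_normed_vector) \<Rightarrow> bool" where
  "real_analytic \<gamma> \<longleftrightarrow>
    (\<forall>s. \<exists>\<epsilon>>0. \<exists>a. \<forall>t. \<bar>t - s\<bar> < \<epsilon> \<longrightarrow> (\<lambda>n. (t - s) ^ n *\<^sub>R a n) sums \<gamma> t)"

definition analytic_jordan_curve_in :: "real \<Rightarrow> (real^3) set \<Rightarrow> bool" where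
  "analytic_jordan_curve_in t C \<longleftrightarrow> C \<subseteq> hplane t \<and>
    (\<exists>\<gamma>. real_analytic \<gamma> \<and> (\<forall>s. \<gamma> (s + 1) = \<gamma> s) \<and> inj_on \<gamma> {0..<1} \<and>
         (\<forall>s. vector_derivative \<gamma> (at s) \<noteq> 0) \<and> range \<gamma> = C)"

definition circle_in :: "real \<Rightarrow> (real^3) set \<Rightarrow> bool" where
  "circle_in t C \<longleftrightarrow> (\<exists>c \<rho>. c \<in> hplane t \<and> 0 < \<rho> \<and> C = sphere c \<rho> \<inter> hplane t)"

text \<open>\<open>hproj\<close> restricts to an isometry from each horizontal plane onto the plane, so
  \<open>enclosed C\<close> is the bounded region which a Jordan curve \<open>C\<close> encloses in its horizontal plane.\<close>

definition hproj :: "real^3 \<Rightarrow> complex" where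
  "hproj x = Complex (x$1) (x$2)"

definition enclosed :: "(real^3) set \<Rightarrow> complex set" where
  "enclosed C = inside (hproj ` C)"

definition convex_curve :: "(real^3) set \<Rightarrow> bool" where
  "convex_curve C \<longleftrightarrow> convex (enclosed C)"

definition strictly_convex_curve :: "(real^3) set \<Rightarrow> bool" where
  "strictly_convex_curve C \<longleftrightarrow>
    (\<forall>x\<in>closure (enclosed C). \<forall>y\<in>closure (enclosed C).
       x \<noteq> y \<longrightarrow> open_segment x y \<subseteq> enclosed C)"

end

theory Submission
  imports Defs "HOL-Complex_Analysis.Complex_Analysis"
begin

text \<open>A maximal surface in Weierstrass form has horizontal part \<open>w = F + cnj G\<close>, with \<open>F\<close> meromorphic
  and \<open>G\<close> holomorphic, and height \<open>Re h\<close>. Such a map is conformal as soon as \<open>h'\<^sup>2 = 4 F' G'\<close>, and then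
  spacelike and maximal wherever \<open>norm F' \<noteq> norm G'\<close>. The surface below lives over the annulus
  \<open>1 \<le> norm z \<le> 4\<close>, its height is an affine function of \<open>ln (norm z)\<close>, and so its level sets are the
  images of the circles \<open>norm z = \<rho>\<close>.

  The starting point is the Moebius map \<open>mob z = (1 - 2 z) / (z - 2)\<close>. It preserves the unit circle,
  and its simple pole at \<open>2\<close> has the shape of a planar end. The degenerate surface \<open>w = mob\<close> has only
  circles as level curves, except that the level \<open>norm z = 2\<close> is a straight line. This
  surface is now deformed in such a way that \<open>w = mob\<close> stays true on the unit circle, which
  keeps that boundary curve a circle. By reflection this forces \<open>F z + G (1 / z) = mob z\<close>, and
  together with \<open>F' z * G' z = eps / z\<^sup>2\<close> one gets a quadratic equation for \<open>fac = F' / mob'\<close>,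
  namely \<open>fac\<^sup>2 = fac + eps * mu\<^sup>2\<close>, where \<open>1 / mu\<close> is the logarithmic derivative
  \<open>z * mob' z / mob z\<close>. For small \<open>eps\<close> its solution near \<open>1\<close> is holomorphic on a neighbourhood of
  the annulus, and \<open>w = mob + corr\<close> with a correction \<open>corr\<close> of size \<open>eps\<close>.

  All remaining claims are perturbation statements. The correction has a Lipschitz constant of size
  \<open>eps\<close>, so \<open>w\<close> is injective like \<open>mob\<close> (\<open>inj_on_hor\<close>). The outer boundary, the image of
  \<open>norm z = 4\<close>, is a perturbation of a circle that is small together with its first two derivatives, hence strictly convex
  (\<open>outer_support\<close>); the first-order term of \<open>corr\<close>, which is an explicit function
  (\<open>hor_first_order\<close>), shows that four of its points do not lie on one circle. The same first-order
  term bends the straight level line \<open>norm z = 2\<close> into a curve that is asymptotic to a vertical line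
  at both ends without being straight. The level curves \<open>norm z = \<rho>\<close> with \<open>\<rho> < 2\<close> close to \<open>2\<close> follow
  this curve and close up very far away, so they are Jordan curves which are not convex
  (\<open>nonconvex_level\<close>).\<close>

section \<open>Points over the horizontal plane\<close>

definition pt :: "complex \<Rightarrow> real \<Rightarrow> real^3" where
  "pt w t = vector [Re w, Im w, t]"

lemma pt_nth [simp]: "pt w t $ 1 = Re w" "pt w t $ 2 = Im w" "pt w t $ 3 = t"
  by (simp_all add: pt_def)

lemma pt_eq_iff [simp]: "pt w t = pt w' t' \<longleftrightarrow> w = w' \<and> t = t'"
  by (auto simp: vec_eq_iff forall_3 complex_eq_iff)

lemma hproj_pt [simp]: "hproj (pt w t) = w"
  by (simp add: hproj_def)

lemma pt_linear_combination:
  "pt w t = Re w *\<^sub>R axis 1 1 + Im w *\<^sub>R axis 2 1 + t *\<^sub>R axis 3 1"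
  by (simp add: vec_eq_iff forall_3 axis_def)

lemma pt_diff: "pt w t - pt w' t' = pt (w - w') (t - t')"
  by (simp add: vec_eq_iff forall_3)

lemma has_derivative_pt:
  assumes "(f has_derivative f') F" "(g has_derivative g') F"
  shows "((\<lambda>x. pt (f x) (g x)) has_derivative (\<lambda>v. pt (f' v) (g' v))) F"
proof -
  have re: "((\<lambda>x. Re (f x)) has_derivative (\<lambda>v. Re (f' v))) F"
    and im: "((\<lambda>x. Im (f x)) has_derivative (\<lambda>v. Im (f' v))) F"
    by (rule bounded_linear.has_derivative[OF bounded_linear_Re assms(1)]
        bounded_linear.has_derivative[OF bounded_linear_Im assms(1)])+
  show ?thesis
    unfolding pt_linear_combination
    by (rule has_derivative_add has_derivative_scaleR_left re im assms(2))+
qed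

lemma tendsto_pt:
  assumes "(f \<longlongrightarrow> a) F" "(g \<longlongrightarrow> b) F"
  shows "((\<lambda>x. pt (f x) (g x)) \<longlongrightarrow> pt a b) F"
  unfolding pt_linear_combination by (intro tendsto_intros assms)

lemma lorentz_pt: "lorentz (pt a s) (pt b t) = Re (a * cnj b) - s * t"
  by (simp add: lorentz_def)

lemma norm_pt_0 [simp]: "norm (pt w 0) = norm w"
proof -
  have "pt w 0 \<bullet> pt w 0 = (norm w)\<^sup>2"
    unfolding cmod_power2 by (simp add: inner_vec_def sum_3 power2_eq_square)
  then show ?thesis by (simp add: norm_eq_sqrt_inner)
qed

lemma dist_pt [simp]: "dist (pt w t) (pt w' t) = dist w w'"
proof -
  show ?thesis by (simp add: dist_norm pt_diff)
qed

lemma hplane_iff: "x \<in> hplane t \<longleftrightarrow> x = pt (hproj x) t"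
  by (simp add: hplane_def hproj_def vec_eq_iff forall_3)

section \<open>Weierstrass representation of maximal surfaces\<close>

text \<open>Only the derivatives \<open>F\<close>, \<open>G\<close>, \<open>h\<close> of the three Weierstrass functions are recorded. They are
  single valued on a domain that is not simply connected, whereas their primitives need not be.\<close>

definition weierstrass_data ::
    "(complex \<Rightarrow> real^3) \<Rightarrow> complex set \<Rightarrow> (complex \<Rightarrow> complex) \<Rightarrow> (complex \<Rightarrow> complex)
      \<Rightarrow> (complex \<Rightarrow> complex) \<Rightarrow> bool" where
  "weierstrass_data X S F G h \<longleftrightarrow>
     open S \<and> F holomorphic_on S \<and> G holomorphic_on S \<and> h holomorphic_on S \<and>
     (\<forall>z\<in>S. (X has_derivative (\<lambda>v. pt (F z * v + cnj (G z * v)) (Re (h z * v)))) (at z))"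

lemma weierstrass_data_dder_eq:
  assumes "weierstrass_data X S F G h" "z \<in> S"
  shows "dder v X z = pt (F z * v + cnj (G z * v)) (Re (h z * v))"
  using assms unfolding weierstrass_data_def dder_def
  by (metis (no_types, lifting) frechet_derivative_at)

text \<open>Directional derivatives of a surface given by Weierstrass data are again given by such data;
  smoothness of every order follows by iteration.\<close>

lemma weierstrass_data_dder:
  assumes D: "weierstrass_data X S F G h"
  shows "weierstrass_data (dder v X) S
           (\<lambda>z. deriv F z * v) (\<lambda>z. deriv G z * v) (\<lambda>z. deriv h z * v)"
proof -
  have S: "open S" and hol: "F holomorphic_on S" "G holomorphic_on S" "h holomorphic_on S"
    using D by (auto simp: weierstrass_data_def)
  have "(dder v X has_derivative
          (\<lambda>u. pt (deriv F z * v * u + cnj (deriv G z * v * u)) (Re (deriv h z * v * u)))) (at z)"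
    if z: "z \<in> S" for z
  proof -
    have d: "(f has_derivative (\<lambda>u. deriv f z * u)) (at z)" if "f holomorphic_on S" for f
      using holomorphic_derivI[OF that S z] by (simp add: has_field_derivative_def)
    have "((\<lambda>z. pt (F z * v + cnj (G z * v)) (Re (h z * v))) has_derivative
          (\<lambda>u. pt (deriv F z * u * v + cnj (deriv G z * u * v)) (Re (deriv h z * u * v)))) (at z)"
      by (intro has_derivative_pt has_derivative_add has_derivative_mult_left
           bounded_linear.has_derivative[OF bounded_linear_cnj]
           bounded_linear.has_derivative[OF bounded_linear_Re] d hol)
    then have "((\<lambda>z. pt (F z * v + cnj (G z * v)) (Re (h z * v))) has_derivative
          (\<lambda>u. pt (deriv F z * v * u + cnj (deriv G z * v * u)) (Re (deriv h z * v * u)))) (at z)"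
      by (simp add: mult_ac)
    then show ?thesis
      by (rule has_derivative_transform_within_open[OF _ S z])
        (simp add: weierstrass_data_dder_eq[OF D])
  qed
  then show ?thesis
    unfolding weierstrass_data_def by (auto intro!: holomorphic_intros S hol)
qed

lemma weierstrass_data_Cinf:
  assumes "weierstrass_data X S F G h"
  shows "Cinf_on X S"
proof -
  have "Ck_on k X S" for k
    using assms
  proof (induction k arbitrary: X F G h)
    case 0
    then have "\<forall>z\<in>S. continuous (at z) X"
      unfolding weierstrass_data_def by (blast intro: has_derivative_continuous)
    then show ?case by (simp add: continuous_at_imp_continuous_on)
  next
    case (Suc k)
    have "\<forall>z\<in>S. X differentiable (at z)"
      using Suc.prems unfolding weierstrass_data_def differentiable_def by blast
    then show ?case
      using Suc.IH[OF weierstrass_data_dder[OF Suc.prems]] by simp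
  qed
  then show ?thesis by (simp add: Cinf_on_def)
qed

text \<open>With \<open>a = F v\<close>, \<open>b = G v\<close>, \<open>c = h v\<close> and \<open>c\<^sup>2 = 4 a b\<close>, the identity
  \<open>(Re c)\<^sup>2 = ((norm c)\<^sup>2 + Re (c\<^sup>2)) / 2\<close> lets the mixed term \<open>2 Re (a b)\<close> of \<open>(norm (a + cnj b))\<^sup>2\<close>
  cancel.\<close>

lemma weierstrass_data_lorentz:
  assumes D: "weierstrass_data X S F G h" and z: "z \<in> S"
    and c: "(h z)\<^sup>2 = 4 * F z * G z"
  shows "lorentz (dder v X z) (dder v X z) = (norm v)\<^sup>2 * (norm (F z) - norm (G z))\<^sup>2"
proof -
  define a b c where abc: "a = F z * v" "b = G z * v" "c = h z * v"
  have c2: "c\<^sup>2 = 4 * (a * b)"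
    using assms(3) by (simp add: abc power2_eq_square)
  have 1: "(Re c)\<^sup>2 = ((norm c)\<^sup>2 + Re (c\<^sup>2)) / 2"
    unfolding cmod_power2 by (simp add: power2_eq_square)
  have 2: "(norm c)\<^sup>2 = 4 * (norm a * norm b)"
    using c2 by (metis norm_mult norm_numeral norm_power)
  have 3: "Re ((a + cnj b) * cnj (a + cnj b)) = (norm a)\<^sup>2 + (norm b)\<^sup>2 + 2 * Re (a * b)"
    by (simp add: cmod_power2) (simp add: power2_eq_square algebra_simps)
  have "lorentz (dder v X z) (dder v X z) = Re ((a + cnj b) * cnj (a + cnj b)) - (Re c)\<^sup>2"
    by (simp add: weierstrass_data_dder_eq[OF D z] lorentz_pt abc power2_eq_square)
  also have "\<dots> = (norm a - norm b)\<^sup>2"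
    unfolding 3 1 2 c2 by (simp add: power2_eq_square field_simps)
  also have "\<dots> = (norm v)\<^sup>2 * (norm (F z) - norm (G z))\<^sup>2"
    by (simp add: abc norm_mult power2_eq_square algebra_simps)
  finally show ?thesis .
qed

lemma weierstrass_data_orthogonal:
  assumes D: "weierstrass_data X S F G h" and z: "z \<in> S"
    and c: "(h z)\<^sup>2 = 4 * F z * G z"
  shows "lorentz (dder 1 X z) (dder \<i> X z) = 0"
proof -
  have c': "Im ((h z)\<^sup>2) = Im (4 * F z * G z)"
    using c by simp
  show ?thesis
    using c' by (simp add: weierstrass_data_dder_eq[OF D z] lorentz_pt power2_eq_square algebra_simps)
qed

lemma weierstrass_data_conformal:
  assumes D: "weierstrass_data X S F G h" and c: "\<And>z. z \<in> S \<Longrightarrow> (h z)\<^sup>2 = 4 * F z * G z"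
  shows "conformal_on X S"
  unfolding conformal_on_def
  by (simp add: weierstrass_data_lorentz[OF D _ c] weierstrass_data_orthogonal[OF D _ c])

text \<open>The coordinate functions are harmonic. In conformal coordinates the numerator of the mean curvature
  is therefore the normal component of a vanishing Laplacian.\<close>

lemma weierstrass_data_maximal:
  assumes D: "weierstrass_data X S F G h" and c: "\<And>z. z \<in> S \<Longrightarrow> (h z)\<^sup>2 = 4 * F z * G z"
    and ne: "\<And>z. z \<in> S \<Longrightarrow> norm (F z) \<noteq> norm (G z)" and K: "K \<subseteq> S"
  shows "maximal_surface X K"
  unfolding maximal_surface_def
proof (intro conjI ballI)
  show "\<exists>U. open U \<and> K \<subseteq> U \<and> Cinf_on X U"
    using D K weierstrass_data_Cinf[OF D] by (auto simp: weierstrass_data_def)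
next
  fix z assume "z \<in> K"
  then have z: "z \<in> S" using K by auto
  show "spacelike_at X z"
    using ne[OF z] by (simp add: spacelike_at_def weierstrass_data_lorentz[OF D z c[OF z]])
  have "dder \<i> (dder \<i> X) z = - dder 1 (dder 1 X) z"
    unfolding weierstrass_data_dder_eq[OF weierstrass_data_dder[OF D] z]
    by (simp add: vec_eq_iff forall_3)
  then have "lorentz (dder \<i> (dder \<i> X) z) N = - lorentz (dder 1 (dder 1 X) z) N" for N
    by (simp add: lorentz_def)
  then show "mean_curvature X z = 0"
    unfolding mean_curvature_def Let_def weierstrass_data_orthogonal[OF D z c[OF z]]
    by (simp add: weierstrass_data_lorentz[OF D z c[OF z]])
qed

lemma lcross_pt:
  "lcross (pt a s) (pt b t) = pt (\<i> * (s *\<^sub>R b - t *\<^sub>R a)) (- Im (cnj a * b))"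
  by (simp add: lcross_def cross3_def vec_eq_iff forall_3)

lemma weierstrass_data_unit_normal:
  assumes D: "weierstrass_data X S F G h" and z: "z \<in> S"
    and c: "(h z)\<^sup>2 = 4 * F z * G z"
  shows "unit_normal X z = (1 / (norm (F z) - norm (G z))\<^sup>2) *\<^sub>R
           pt (cnj (G z) * h z - F z * cnj (h z)) ((norm (G z))\<^sup>2 - (norm (F z))\<^sup>2)"
proof -
  define f g where fg: "f = norm (F z)" "g = norm (G z)"
  define m where "m = cnj (G z) * h z - F z * cnj (h z)"
  have n: "lcross (dder 1 X z) (dder \<i> X z) = pt m (g\<^sup>2 - f\<^sup>2)"
    unfolding weierstrass_data_dder_eq[OF D z] lcross_pt pt_eq_iff
    by (simp add: complex_eq_iff m_def fg cmod_power2 algebra_simps) (simp add: power2_eq_square algebra_simps)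
  have h2: "(norm (h z))\<^sup>2 = 4 * (f * g)"
    using c by (metis fg mult.assoc norm_mult norm_numeral norm_power)
  have "Re (m * cnj m) = (norm (h z))\<^sup>2 * (f\<^sup>2 + g\<^sup>2) - 2 * Re (cnj (F z * G z) * (h z)\<^sup>2)"
    unfolding m_def fg cmod_power2 by (simp add: power2_eq_square algebra_simps)
  also have "Re (cnj (F z * G z) * (h z)\<^sup>2) = 4 * (f * g)\<^sup>2"
    unfolding c fg power_mult_distrib cmod_power2 by (simp add: power2_eq_square algebra_simps)
  finally have "- lorentz (pt m (g\<^sup>2 - f\<^sup>2)) (pt m (g\<^sup>2 - f\<^sup>2)) = ((f - g)\<^sup>2)\<^sup>2"
    unfolding lorentz_pt h2 by (simp add: power2_eq_square algebra_simps)
  then have "sqrt (- lorentz (pt m (g\<^sup>2 - f\<^sup>2)) (pt m (g\<^sup>2 - f\<^sup>2))) = (f - g)\<^sup>2"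
    by (simp add: real_sqrt_unique)
  then show ?thesis
    unfolding unit_normal_def Let_def n by (simp add: fg m_def)
qed

text \<open>The quotient \<open>F / G\<close> is the square of the Gauss map in stereographic
  coordinates, so where it vanishes the normal is vertical. The estimates use only
  \<open>x = norm (F / G)\<close>: the vertical component of the unit normal is \<open>(1 - x\<^sup>2) / (1 - x)\<^sup>2\<close> and the
  horizontal one is at most of the order of \<open>sqrt x\<close>.\<close>

lemma weierstrass_data_normal_limit:
  assumes D: "weierstrass_data X S F G h"
    and c: "\<And>z. z \<in> S \<Longrightarrow> (h z)\<^sup>2 = 4 * F z * G z"
    and G_deriv: "\<And>z. z \<in> S \<Longrightarrow> G z \<noteq> 0"
    and S: "eventually (\<lambda>z. z \<in> S) (at p)"
    and lim: "((\<lambda>z. F z / G z) \<longlongrightarrow> 0) (at p)"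
  shows "(unit_normal X \<longlongrightarrow> axis 3 1) (at p)"
proof -
  define x where "x z = norm (F z / G z)" for z
  have x: "(x \<longlongrightarrow> 0) (at p)"
    unfolding x_def using lim by (simp add: tendsto_norm_zero_iff)
  define m where "m z = (1 / (norm (F z) - norm (G z))\<^sup>2) *\<^sub>R (cnj (G z) * h z - F z * cnj (h z))" for z
  define t where "t z = (1 / (norm (F z) - norm (G z))\<^sup>2) * ((norm (G z))\<^sup>2 - (norm (F z))\<^sup>2)" for z
  have N: "eventually (\<lambda>z. pt (m z) (t z) = unit_normal X z) (at p)"
    using S
  proof eventually_elim
    case (elim z)
    show ?case
      unfolding weierstrass_data_unit_normal[OF D elim c[OF elim]] m_def t_def
      by (simp add: vec_eq_iff forall_3)
  qed
  have tx: "t z = (1 - (x z)\<^sup>2) / (1 - x z)\<^sup>2" if z: "z \<in> S" for z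
  proof -
    define g where "g = norm (G z)"
    have g: "g \<noteq> 0" using G_deriv[OF z] by (simp add: g_def)
    have "norm (F z) = x z * g" by (simp add: x_def norm_divide g_def[symmetric] g)
    then have "t z = (g\<^sup>2 * (1 - (x z)\<^sup>2)) / (g\<^sup>2 * (1 - x z)\<^sup>2)"
      unfolding t_def g_def[symmetric]
      by (auto simp: power2_eq_square algebra_simps)
    then show ?thesis using g by simp
  qed
  have mx: "norm (m z) \<le> 2 * sqrt (x z) * (1 + x z) * 1 / (1 - x z)\<^sup>2" if z: "z \<in> S" for z
  proof -
    define g where "g = norm (G z)"
    have g: "g > 0" using G_deriv[OF z] by (simp add: g_def)
    have f: "norm (F z) = x z * g" using g by (simp add: x_def norm_divide g_def[symmetric])
    have x0: "x z \<ge> 0" by (simp add: x_def)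
    have "(norm (h z))\<^sup>2 = 4 * (norm (F z) * norm (G z))"
      using c[OF z] by (metis mult.assoc norm_mult norm_numeral norm_power)
    then have "(norm (h z))\<^sup>2 = (2 * sqrt (x z) * g)\<^sup>2"
      using x0 by (simp add: f g_def[symmetric] power_mult_distrib power2_eq_square)
    then have h: "norm (h z) = 2 * sqrt (x z) * g"
      using x0 g by (simp add: power2_eq_iff_nonneg)
    have "norm (cnj (G z) * h z - F z * cnj (h z)) \<le> g * norm (h z) + norm (F z) * norm (h z)"
      unfolding g_def by (rule order_trans[OF norm_triangle_ineq4]) (simp add: norm_mult)
    also have "\<dots> = g\<^sup>2 * (2 * sqrt (x z) * (1 + x z))"
      unfolding h f by (simp add: power2_eq_square algebra_simps)
    finally have "norm (m z) \<le> (g\<^sup>2 * (2 * sqrt (x z) * (1 + x z))) / (x z * g - g)\<^sup>2"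
      unfolding m_def f g_def[symmetric] by (simp add: divide_right_mono)
    also have "(x z * g - g)\<^sup>2 = g\<^sup>2 * (1 - x z)\<^sup>2"
      by (simp add: power2_eq_square algebra_simps)
    finally show ?thesis using g by simp
  qed
  have "((\<lambda>z. (1 - (x z)\<^sup>2) / (1 - x z)\<^sup>2) \<longlongrightarrow> (1 - 0\<^sup>2) / (1 - 0)\<^sup>2) (at p)"
    by (intro tendsto_intros x) auto
  moreover have "eventually (\<lambda>z. (1 - (x z)\<^sup>2) / (1 - x z)\<^sup>2 = t z) (at p)"
    using S by eventually_elim (simp add: tx)
  ultimately have t: "(t \<longlongrightarrow> (1 - 0\<^sup>2) / (1 - 0)\<^sup>2) (at p)"
    by (rule Lim_transform_eventually)
  have "((\<lambda>z. 2 * sqrt (x z) * (1 + x z) * 1 / (1 - x z)\<^sup>2) \<longlongrightarrow> 2 * sqrt 0 * (1 + 0) * 1 / (1 - 0)\<^sup>2) (at p)"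
    by (intro tendsto_intros x) auto
  then have "((\<lambda>z. 2 * sqrt (x z) * (1 + x z) * 1 / (1 - x z)\<^sup>2) \<longlongrightarrow> 0) (at p)"
    by simp
  moreover have "eventually (\<lambda>z. norm (m z) \<le> 2 * sqrt (x z) * (1 + x z) * 1 / (1 - x z)\<^sup>2) (at p)"
    using S by eventually_elim (rule mx)
  ultimately have "(m \<longlongrightarrow> 0) (at p)"
    by (rule Lim_null_comparison[rotated])
  with t have "((\<lambda>z. pt (m z) (t z)) \<longlongrightarrow> pt 0 1) (at p)"
    by (intro tendsto_pt) auto
  moreover have "pt 0 1 = axis 3 1" by (simp add: pt_linear_combination)
  ultimately show ?thesis
    using Lim_transform_eventually[OF _ N] by metis
qed

text \<open>An orientation-reversing affine change of the parameter exchanges the roles of \<open>F\<close> and \<open>G\<close>. The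
  coordinate of the planar end below is of this kind.\<close>

lemma weierstrass_data_reflected_affine:
  assumes D: "weierstrass_data X S F G h" and T: "open T"
    and sub: "\<And>z. z \<in> T \<Longrightarrow> a + b * cnj z \<in> S"
  shows "weierstrass_data (X \<circ> (\<lambda>z. a + b * cnj z)) T
           (\<lambda>z. cnj (b * G (a + b * cnj z))) (\<lambda>z. cnj (b * F (a + b * cnj z)))
           (\<lambda>z. cnj (b * h (a + b * cnj z)))"
proof -
  have S: "open S" and hol: "F holomorphic_on S" "G holomorphic_on S" "h holomorphic_on S"
    using D by (auto simp: weierstrass_data_def)
  have hol_refl: "(\<lambda>z. cnj (b * f (a + b * cnj z))) holomorphic_on T" if f: "f holomorphic_on S" for f
  proof -
    have "(f \<circ> (\<lambda>z. a + b * z)) holomorphic_on cnj ` T"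
      by (rule holomorphic_on_compose_gen[OF _ f]) (auto intro!: holomorphic_intros sub)
    then have "(\<lambda>z. b * f (a + b * z)) holomorphic_on cnj ` T"
      by (auto intro!: holomorphic_intros simp: o_def)
    from holomorphic_on_compose_cnj_cnj[OF this T] show ?thesis by (simp add: o_def)
  qed
  have "(X \<circ> (\<lambda>z. a + b * cnj z) has_derivative
          (\<lambda>v. pt (cnj (b * G (a + b * cnj z)) * v + cnj (cnj (b * F (a + b * cnj z)) * v))
            (Re (cnj (b * h (a + b * cnj z)) * v)))) (at z)" if z: "z \<in> T" for z
  proof -
    define q where "q = a + b * cnj z"
    have "((\<lambda>z. a + b * cnj z) has_derivative (\<lambda>v. b * cnj v)) (at z)"
      by (auto intro!: derivative_eq_intros bounded_linear.has_derivative[OF bounded_linear_cnj])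
    moreover have "(X has_derivative (\<lambda>v. pt (F q * v + cnj (G q * v)) (Re (h q * v)))) (at q)"
      using D sub[OF z] unfolding weierstrass_data_def q_def by blast
    ultimately have "(X \<circ> (\<lambda>z. a + b * cnj z) has_derivative
        (\<lambda>v. pt (F q * v + cnj (G q * v)) (Re (h q * v))) \<circ> (\<lambda>v. b * cnj v)) (at z)"
      unfolding q_def by (rule diff_chain_at)
    moreover have "(\<lambda>v. pt (F q * v + cnj (G q * v)) (Re (h q * v))) \<circ> (\<lambda>v. b * cnj v) =
      (\<lambda>v. pt (cnj (b * G q) * v + cnj (cnj (b * F q) * v)) (Re (cnj (b * h q) * v)))"
      by (rule ext) (simp add: complex_eq_iff algebra_simps)
    ultimately show ?thesis by (simp add: q_def)
  qed
  then show ?thesis unfolding weierstrass_data_def using T hol hol_refl by blast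
qed

section \<open>Convex and non-convex Jordan curves\<close>

text \<open>Every point \<open>a\<close> of the curve maximises a linear functional uniquely on the curve, hence also on the
  convex hull \<open>K\<close>. So the curve avoids the interior of \<open>K\<close>, and since this interior is connected it
  coincides with the inside of the curve. A segment of \<open>K\<close> whose relative interior met the curve in \<open>m\<close>
  would contradict the uniqueness of the maximiser \<open>m\<close>.\<close>

lemma inside_closed_curve_with_strict_supports:
  fixes \<gamma> :: "real \<Rightarrow> complex"
  assumes \<gamma>: "simple_path \<gamma>" "pathfinish \<gamma> = pathstart \<gamma>"
    and supp: "\<And>a. a \<in> path_image \<gamma> \<Longrightarrow>
        \<exists>n. \<forall>b\<in>path_image \<gamma> - {a}. n \<bullet> b < n \<bullet> a"
    and x: "x \<in> closure (inside (path_image \<gamma>))" and y: "y \<in> closure (inside (path_image \<gamma>))"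
    and xy: "x \<noteq> y"
  shows "open_segment x y \<subseteq> inside (path_image \<gamma>)"
proof -
  define C where "C = path_image \<gamma>"
  define K where "K = convex hull C"
  have J: "inside C \<noteq> {}" "open (inside C)" "inside C \<inter> outside C = {}"
      "inside C \<union> outside C = - C" "frontier (inside C) = C" "\<not> bounded (outside C)"
    using Jordan_inside_outside[OF \<gamma>] by (auto simp: C_def)
  have cC: "compact C"
    unfolding C_def using \<gamma>(1) by (intro compact_path_image simple_path_imp_path)
  have cK: "compact K" "convex K"
    using cC by (auto simp: K_def compact_convex_hull)
  have CK: "C \<subseteq> K" by (simp add: K_def hull_subset)
  have supp': "\<exists>n. \<forall>b\<in>K - {a}. n \<bullet> b < n \<bullet> a" if a: "a \<in> C" for a
  proof -
    obtain n where n: "\<And>b. b \<in> C - {a} \<Longrightarrow> n \<bullet> b < n \<bullet> a"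
      using supp a unfolding C_def by blast
    (* An open half plane together with one boundary point is convex. *)
    define T where "T = insert a {b. n \<bullet> b < n \<bullet> a}"
    have "convex T"
      unfolding convex_alt
    proof (intro ballI allI impI)
      fix b b' and u :: real assume b: "b \<in> T" "b' \<in> T" and u: "0 \<le> u \<and> u \<le> 1"
      show "(1 - u) *\<^sub>R b + u *\<^sub>R b' \<in> T"
      proof (cases "u = 0 \<or> u = 1 \<or> (b = a \<and> b' = a)")
        case True
        then show ?thesis using b by (auto simp: algebra_simps)
      next
        case False
        have le: "n \<bullet> b \<le> n \<bullet> a" "n \<bullet> b' \<le> n \<bullet> a" using b by (auto simp: T_def)
        have "(1 - u) * (n \<bullet> b) + u * (n \<bullet> b') < (1 - u) * (n \<bullet> a) + u * (n \<bullet> a)"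
        proof (cases "b = a")
          case True
          then have "n \<bullet> b' < n \<bullet> a" using False b by (auto simp: T_def)
          then show ?thesis using True False u by simp
        next
          case False': False
          then have "n \<bullet> b < n \<bullet> a" using b by (auto simp: T_def)
          then show ?thesis using False u le
            by (intro add_less_le_mono mult_strict_left_mono mult_left_mono) auto
        qed
        then show ?thesis by (simp add: T_def inner_add_right algebra_simps)
      qed
    qed
    moreover have "C \<subseteq> T" using n by (auto simp: T_def)
    ultimately have "K \<subseteq> T" by (simp add: K_def hull_minimal)
    then show ?thesis by (intro exI[of _ n]) (auto simp: T_def)
  qed
  have "- K \<subseteq> outside C"
    by (intro outside_subset_convex cK CK)
  then have "inside C \<subseteq> K" using J by blast
  then have inK: "inside C \<subseteq> interior K"
    using J(2) by (simp add: interior_maximal)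
  have disj: "interior K \<inter> C = {}"
  proof (rule ccontr)
    assume "interior K \<inter> C \<noteq> {}"
    then obtain a where a: "a \<in> interior K" "a \<in> C" by auto
    then obtain n where n: "\<And>b. b \<in> K - {a} \<Longrightarrow> n \<bullet> b < n \<bullet> a" using supp' by blast
    obtain e where e: "e > 0" "ball a e \<subseteq> K" using a mem_interior by blast
    define v where "v = (if n = 0 then 1 else n)"
    define b where "b = a + (e / (2 * norm v)) *\<^sub>R v"
    have v: "v \<noteq> 0" by (simp add: v_def)
    have "dist a b < e" using e v by (simp add: b_def dist_norm)
    then have "b \<in> K" using e by auto
    moreover have "b \<noteq> a" using e v by (simp add: b_def)
    ultimately have "n \<bullet> b < n \<bullet> a" using n by auto
    moreover have "n \<bullet> b \<ge> n \<bullet> a"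
      using e by (auto simp: b_def v_def inner_add_right)
    ultimately show False by simp
  qed
  have "interior K \<subseteq> inside C"
  proof -
    have conn: "connected (interior K)" using cK by (simp add: convex_connected convex_interior)
    have "interior K \<subseteq> inside C \<union> outside C" using disj J by auto
    moreover have "open (outside C)" using cC by (simp add: open_outside compact_imp_closed)
    ultimately have "interior K \<inter> inside C = {} \<or> interior K \<inter> outside C = {}"
      using connectedD[OF conn J(2)] J(3) by blast
    then show ?thesis using inK J disj by blast
  qed
  with inK have eq: "inside C = interior K" by auto
  have xK: "x \<in> K" "y \<in> K"
    using x y inK cK compact_imp_closed[OF cK(1)] interior_subset closure_minimal unfolding C_def[symmetric]
    by (meson in_mono order_trans)+
  show ?thesis
  proof
    fix m assume m: "m \<in> open_segment x y"
    show "m \<in> inside (path_image \<gamma>)"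
    proof (rule ccontr)
      assume "m \<notin> inside (path_image \<gamma>)"
      then have mi: "m \<notin> interior K" by (simp add: eq[symmetric] C_def)
      have mK: "m \<in> K" using m xK cK(2) by (meson closed_segment_subset open_closed_segment subsetD)
      have "closure (interior K) = K"
        using J(1) eq cK compact_imp_closed convex_closure_interior closure_closed by metis
      then have "m \<in> frontier (inside C)"
        using mi mK by (simp add: eq frontier_def)
      then have "m \<in> C" by (simp add: J)
      then obtain n where n: "\<And>b. b \<in> K - {m} \<Longrightarrow> n \<bullet> b < n \<bullet> m" using supp' by blast
      obtain u where u: "0 < u" "u < 1" "m = (1 - u) *\<^sub>R x + u *\<^sub>R y"
        using m by (auto simp: in_segment)
      have "x \<noteq> m" "y \<noteq> m" using m by (auto simp: open_segment_def)
      then have "n \<bullet> x < n \<bullet> m" "n \<bullet> y < n \<bullet> m" using n xK by auto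
      then have "(1 - u) * (n \<bullet> x) + u * (n \<bullet> y) < (1 - u) * (n \<bullet> m) + u * (n \<bullet> m)"
        using u by (intro add_strict_mono mult_strict_left_mono) auto
      moreover have "n \<bullet> m = (1 - u) * (n \<bullet> x) + u * (n \<bullet> y)"
        by (simp add: u(3) inner_add_right)
      ultimately show False by (simp add: algebra_simps)
    qed
  qed
qed

text \<open>Twice the signed area of the triangle \<open>a\<close>, \<open>b\<close>, \<open>c\<close>.\<close>

definition orient :: "complex \<Rightarrow> complex \<Rightarrow> complex \<Rightarrow> real" where
  "orient a b c = Im (cnj (b - a) * (c - a))"

lemma scaled_orient: "orient (of_real k * a) (of_real k * b) (of_real k * c) = k\<^sup>2 * orient a b c"
  by (simp add: orient_def power2_eq_square algebra_simps)

lemma orient_coordinates: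
  "orient a b c = (Re b - Re a) * (Im c - Im a) - (Im b - Im a) * (Re c - Re a)"
  by (simp add: orient_def algebra_simps)

text \<open>A convex open set is the interior of its closure. If the inside of the curve were convex, the open
  triangle spanned by \<open>a\<close>, \<open>b\<close>, \<open>c\<close> would thus lie inside the curve; but its point \<open>q\<close> is on the curve.
  The three negative orientations express that \<open>q\<close> lies in the open triangle, with barycentric
  coordinates given by Cramer's rule.\<close>

lemma nonconvex_inside_if_point_in_triangle:
  fixes \<gamma> :: "real \<Rightarrow> complex"
  assumes \<gamma>: "simple_path \<gamma>" "pathfinish \<gamma> = pathstart \<gamma>"
    and mem: "a \<in> path_image \<gamma>" "b \<in> path_image \<gamma>" "c \<in> path_image \<gamma>" "q \<in> path_image \<gamma>"
    and neg: "orient a b q < 0" "orient b c q < 0" "orient c a q < 0"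
  shows "\<not> convex (inside (path_image \<gamma>))"
proof
  define C where "C = path_image \<gamma>"
  assume conv: "convex (inside (path_image \<gamma>))"
  have J: "open (inside C)" "frontier (inside C) = C"
    using Jordan_inside_outside[OF \<gamma>] by (auto simp: C_def)
  define D where "D = orient a b q + orient b c q + orient c a q"
  have D: "D < 0" using neg by (simp add: D_def)
  have DD: "D = orient a b c"
    by (simp add: D_def orient_def algebra_simps)
  have ncol: "\<not> collinear {a, b, c}"
  proof
    assume "collinear {a, b, c}"
    then have "a = c \<or> (\<exists>u. b = u *\<^sub>R a + (1 - u) *\<^sub>R c)"
      by (simp add: collinear_3_expand)
    then have "orient a b c = 0"
    proof (elim disjE exE)
      fix u assume b: "b = u *\<^sub>R a + (1 - u) *\<^sub>R c"
      show ?thesis unfolding b by (simp add: orient_def) (simp add: algebra_simps)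
    qed (simp add: orient_def)
    then show False using D DD by simp
  qed
  have eqD: "D *\<^sub>R q = orient b c q *\<^sub>R a + orient c a q *\<^sub>R b + orient a b q *\<^sub>R c"
    by (simp add: D_def orient_def complex_eq_iff algebra_simps)
  have "q = (1 / D) *\<^sub>R (D *\<^sub>R q)" using D by simp
  then have q: "(orient b c q / D) *\<^sub>R a + (orient c a q / D) *\<^sub>R b + (orient a b q / D) *\<^sub>R c = q"
    unfolding eqD by (simp add: scaleR_add_right)
  have "q \<in> interior (convex hull {a, b, c})"
    unfolding interior_convex_hull_3_minimal[OF ncol DIM_complex] mem_Collect_eq
    using neg D q
    by (intro exI[of _ "orient b c q / D"] exI[of _ "orient c a q / D"] exI[of _ "orient a b q / D"] conjI)
      (auto simp: divide_neg_neg D_def add_divide_distrib[symmetric])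
  moreover have "convex hull {a, b, c} \<subseteq> closure (inside C)"
    using mem J(2) conv unfolding C_def
    by (intro hull_minimal convex_closure) (auto simp: frontier_def)
  ultimately have "q \<in> interior (closure (inside C))"
    using interior_mono by blast
  also have "interior (closure (inside C)) = inside C"
    using conv J(1) by (simp add: C_def convex_interior_closure interior_open)
  finally show False
    using mem(4) J by (auto simp: C_def frontier_def interior_open)
qed

section \<open>The deformed Moebius map\<close>

text \<open>The deformation parameter. Among the estimates below, the one that asks most of its smallness is the
  strict convexity of the outer boundary, where \<open>32760 * eps\<close> must stay below \<open>1 / 21600\<close>.\<close>

definition eps :: real where "eps = 1 / 10 ^ 10"

text \<open>An open neighbourhood of the annulus \<open>1 \<le> norm z \<le> 4\<close>, invariant under \<open>z \<mapsto> 1 / z\<close>.\<close>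

definition collar :: "complex set" where "collar = {z. 1/5 < norm z \<and> norm z < 5}"

definition mob :: "complex \<Rightarrow> complex" where "mob z = (1 - 2 * z) / (z - 2)"

text \<open>The reciprocal of the logarithmic derivative \<open>z * mob' z / mob z\<close>.\<close>

definition mu :: "complex \<Rightarrow> complex" where "mu z = (5 - 2 * (z + 1 / z)) / 3"

text \<open>The root near \<open>1\<close> of \<open>fac\<^sup>2 = fac + eps * mu\<^sup>2\<close>; it is the factor \<open>F' / mob'\<close>.\<close>

definition fac :: "complex \<Rightarrow> complex" where
  "fac z = (1 + csqrt (1 + 4 * of_real eps * (mu z)\<^sup>2)) / 2"

text \<open>This is \<open>z * V' z\<close>, where \<open>V\<close> is the part of \<open>F\<close> that is added to \<open>mob\<close>:
  \<open>z * V' z = (fac z - 1) * (z * mob' z)\<close>. Written with \<open>fac - 1 = eps * mu\<^sup>2 / fac\<close>, the double zero of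
  \<open>mu\<^sup>2\<close> at \<open>2\<close> cancels the double pole of \<open>mob'\<close>, so that \<open>dens\<close> is holomorphic at the puncture.\<close>

definition dens :: "complex \<Rightarrow> complex" where
  "dens z = of_real eps * (2 * z - 1)\<^sup>2 / (3 * z * fac z)"

lemma eps_pos: "0 < eps" by (simp add: eps_def)

lemma open_collar: "open collar"
  unfolding collar_def by (intro open_Collect_conj open_Collect_less continuous_intros)

lemma collar_nonzero: "z \<in> collar \<Longrightarrow> z \<noteq> 0" by (auto simp: collar_def)

lemma collar_inverse: "z \<in> collar \<Longrightarrow> 1 / z \<in> collar"
  using collar_nonzero[of z] by (auto simp: collar_def norm_divide less_divide_eq divide_less_eq)

lemma norm_mu_le: assumes "z \<in> collar" shows "norm (mu z) \<le> 9"
proof -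
  have "norm (z + 1 / z) \<le> norm z + norm (1 / z)" by (rule norm_triangle_ineq)
  also have "\<dots> \<le> 5 + 5"
    using assms collar_inverse[OF assms] by (intro add_mono) (auto simp: collar_def)
  finally have "norm (2 * (z + 1 / z)) \<le> 20" by (simp only: norm_mult norm_numeral)
  then have "norm (5 - 2 * (z + 1 / z)) \<le> 5 + 2 * 10"
    using norm_triangle_ineq4[of 5 "2 * (z + 1 / z)"] by (simp only: norm_numeral)
  then show ?thesis by (simp add: mu_def norm_divide)
qed

lemma norm_radicand: assumes "z \<in> collar" shows "norm (4 * of_real eps * (mu z)\<^sup>2) \<le> 324 * eps"
proof -
  have "(norm (mu z))\<^sup>2 \<le> 9\<^sup>2" using norm_mu_le[OF assms] by (intro power_mono) auto
  then show ?thesis using eps_pos by (simp add: norm_mult norm_power)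
qed

lemma radicand_not_nonpos:
  assumes "z \<in> collar" shows "1 + 4 * of_real eps * (mu z)\<^sup>2 \<notin> \<real>\<^sub>\<le>\<^sub>0"
proof -
  have "\<bar>Re (4 * of_real eps * (mu z)\<^sup>2)\<bar> < 1"
    using norm_radicand[OF assms] abs_Re_le_cmod[of "4 * of_real eps * (mu z)\<^sup>2"] by (simp add: eps_def)
  then show ?thesis by (auto simp: complex_nonpos_Reals_iff)
qed

lemma holomorphic_on_fac: "fac holomorphic_on collar"
  unfolding fac_def mu_def
  using radicand_not_nonpos collar_nonzero
  by (intro holomorphic_intros) (auto simp: mu_def)

lemma fac_quadratic: "(fac z)\<^sup>2 = fac z + of_real eps * (mu z)\<^sup>2"
proof -
  have "(csqrt (1 + 4 * of_real eps * (mu z)\<^sup>2))\<^sup>2 = 1 + 4 * of_real eps * (mu z)\<^sup>2" by simp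
  then show ?thesis
    unfolding fac_def power_divide power2_sum by (simp add: field_simps)
qed

text \<open>The principal square root has non-negative real part.\<close>

lemma norm_fac_ge: "norm (fac z) \<ge> 1 / 2"
proof -
  have "Re (fac z) \<ge> 1 / 2"
    using csqrt_principal[of "1 + 4 * of_real eps * (mu z)\<^sup>2"] by (auto simp: fac_def)
  then show ?thesis using complex_Re_le_cmod[of "fac z"] by linarith
qed

lemma fac_nonzero: "fac z \<noteq> 0" using norm_fac_ge[of z] by auto

lemma fac_inverse: "fac (1 / z) = fac z"
  by (simp add: fac_def mu_def add.commute)

lemma fac_cnj: "z \<in> collar \<Longrightarrow> fac (cnj z) = cnj (fac z)"
  using radicand_not_nonpos[of z] cnj_csqrt[of "1 + 4 * of_real eps * (mu z)\<^sup>2"]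
  by (simp add: fac_def mu_def)

lemma holomorphic_on_dens: "dens holomorphic_on collar"
  unfolding dens_def using fac_nonzero collar_nonzero
  by (intro holomorphic_intros holomorphic_on_fac) auto

lemma dens_cnj: "z \<in> collar \<Longrightarrow> dens (cnj z) = cnj (dens z)"
  by (simp add: dens_def fac_cnj)

lemma norm_dens_main_le:
  assumes "z \<in> collar" shows "norm ((2 * z - 1)\<^sup>2 / (3 * z)) \<le> 210"
proof -
  have z: "1/5 < norm z" "norm z < 5" using assms by (auto simp: collar_def)
  have "norm (2 * z - 1) \<le> 11"
    using norm_triangle_ineq4[of "2 * z" 1] z by (simp add: norm_mult)
  then have "(norm (2 * z - 1))\<^sup>2 \<le> 11\<^sup>2" by (intro power_mono) auto
  then have "(norm (2 * z - 1))\<^sup>2 \<le> 210 * (3 * norm z)" using z by simp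
  moreover have "0 < norm z" using z by linarith
  ultimately show ?thesis by (simp add: norm_divide norm_mult norm_power divide_le_eq)
qed

lemma norm_dens_le:
  assumes "z \<in> collar" shows "norm (dens z) \<le> 420 * eps"
proof -
  have "norm (dens z) = eps * norm ((2 * z - 1)\<^sup>2 / (3 * z)) * (1 / norm (fac z))"
    using eps_pos by (simp add: dens_def norm_mult norm_divide)
  also have "\<dots> \<le> eps * 210 * (1 / (1 / 2))"
    using norm_fac_ge[of z] fac_nonzero[of z] eps_pos norm_dens_main_le[OF assms]
    by (intro mult_mono divide_left_mono mult_nonneg_nonneg) auto
  finally show ?thesis by simp
qed

lemma dens_first_order:
  assumes "z \<in> collar" shows "norm (dens z - of_real eps * ((2 * z - 1)\<^sup>2 / (3 * z))) \<le> 70000 * eps\<^sup>2"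
proof -
  have eq: "of_real eps * (mu z)\<^sup>2 = (fac z)\<^sup>2 - fac z"
    using fac_quadratic[of z] by simp
  have "1 / fac z - 1 = - (of_real eps * (mu z)\<^sup>2 / (fac z)\<^sup>2)"
    unfolding eq using fac_nonzero[of z] by (simp add: field_simps power2_eq_square)
  moreover have "norm (of_real eps * (mu z)\<^sup>2 / (fac z)\<^sup>2) \<le> eps * 9\<^sup>2 / (1 / 2)\<^sup>2"
    unfolding norm_divide norm_mult norm_power
    using norm_mu_le[OF assms] norm_fac_ge[of z] eps_pos
    by (intro frac_le mult_mono power_mono) auto
  ultimately have 1: "norm (1 / fac z - 1) \<le> 324 * eps" by (simp add: power_divide)
  have "dens z - of_real eps * ((2 * z - 1)\<^sup>2 / (3 * z)) =
      of_real eps * ((2 * z - 1)\<^sup>2 / (3 * z)) * (1 / fac z - 1)"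
    using fac_nonzero[of z] collar_nonzero[OF assms] by (simp add: dens_def field_simps)
  then have "norm (dens z - of_real eps * ((2 * z - 1)\<^sup>2 / (3 * z))) =
      eps * norm ((2 * z - 1)\<^sup>2 / (3 * z)) * norm (1 / fac z - 1)"
    using eps_pos by (simp only: norm_mult norm_of_real abs_of_pos)
  also have "\<dots> \<le> eps * 210 * (324 * eps)"
    using 1 eps_pos norm_dens_main_le[OF assms] by (intro mult_mono mult_nonneg_nonneg) auto
  also have "\<dots> \<le> 70000 * eps\<^sup>2" using eps_pos by (simp add: power2_eq_square)
  finally show ?thesis .
qed

section \<open>The horizontal correction\<close>

text \<open>The preimage of \<open>collar\<close> under \<open>exp\<close>. The correction is constructed in the logarithmic coordinate
  \<open>s\<close>, where the domain is convex and primitives exist.\<close>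

definition strip :: "complex set" where "strip = {s. \<bar>Re s\<bar> < ln 5}"

lemma open_strip: "open strip"
  unfolding strip_def by (intro open_Collect_less continuous_intros)

lemma convex_strip: "convex strip"
proof -
  have eq: "strip = {s. Re s < ln 5} \<inter> {s. Re s > - ln 5}" by (auto simp: strip_def)
  show ?thesis
    unfolding eq by (intro convex_Int convex_halfspace_Re_lt convex_halfspace_Re_gt)
qed

lemma exp_strip_iff: "exp s \<in> collar \<longleftrightarrow> s \<in> strip"
proof -
  have "1 / 5 < exp (Re s) \<longleftrightarrow> ln (1 / 5) < Re s"
    by (metis exp_less_cancel_iff exp_ln zero_less_divide_1_iff zero_less_numeral)
  moreover have "exp (Re s) < 5 \<longleftrightarrow> Re s < ln 5"
    by (metis exp_less_cancel_iff exp_ln zero_less_numeral)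
  ultimately show ?thesis by (auto simp: collar_def strip_def ln_div)
qed

lemma zero_strip: "Re s = 0 \<Longrightarrow> s \<in> strip"
  by (simp add: strip_def)

lemma strip_reflect: "- cnj s \<in> strip \<longleftrightarrow> s \<in> strip" "- s \<in> strip \<longleftrightarrow> s \<in> strip"
   "cnj s \<in> strip \<longleftrightarrow> s \<in> strip"
  by (auto simp: strip_def)

lemma ln_numerals: "ln 4 = 2 * ln (2::real)" "(0::real) < ln 2" "ln 2 < (1::real)" "ln 4 < ln (5::real)"
    "ln 5 < (2::real)"
proof -
  show "ln 4 = 2 * ln (2::real)" using ln_realpow[of 2 2] by simp
  show "(0::real) < ln 2" by simp
  show "ln 2 < (1::real)" using ln_2_less_1 by simp
  show "ln 4 < ln (5::real)" by simp
  have "(1 + 1 / real 2 * 1) ^ 2 \<le> exp (1::real)"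
    using exp_ge_one_plus_x_over_n_power_n[of 2 1] by simp
  then have "(9 / 4) ^ 2 \<le> (exp (1::real))\<^sup>2" by (intro power_mono) (auto simp: power2_eq_square)
  then have "5 < exp (2::real)" by (simp add: power2_eq_square exp_add[symmetric])
  then show "ln 5 < (2::real)" by (metis exp_less_cancel_iff exp_ln zero_less_numeral)
qed

lemma holomorphic_on_dens_exp: "(\<lambda>s. dens (exp s)) holomorphic_on strip"
  using holomorphic_on_compose_gen[OF holomorphic_on_exp holomorphic_on_dens, of strip]
    exp_strip_iff by (simp add: o_def image_subset_iff)

lemma dens_exp_primitive:
  "\<exists>U. \<forall>s\<in>strip. (U has_field_derivative dens (exp s)) (at s)"
proof -
  obtain U where "\<And>s. s \<in> strip \<Longrightarrow> (U has_field_derivative dens (exp s)) (at s within strip)"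
    using holomorphic_convex_primitive'[OF convex_strip open_strip holomorphic_on_dens_exp] by blast
  then show ?thesis using at_within_open[OF _ open_strip] by metis
qed

definition prim :: "complex \<Rightarrow> complex" where
  "prim = (SOME U. \<forall>s\<in>strip. (U has_field_derivative dens (exp s)) (at s))"

lemma has_field_derivative_prim:
  "s \<in> strip \<Longrightarrow> (prim has_field_derivative dens (exp s)) (at s)"
  unfolding prim_def using someI_ex[OF dens_exp_primitive] by blast

text \<open>In the coordinate \<open>z = exp s\<close> this is \<open>V z - V (1 / cnj z)\<close>. The reflection \<open>z \<mapsto> 1 / cnj z\<close> in
  the unit circle becomes \<open>s \<mapsto> - cnj s\<close>.\<close>

definition corr :: "complex \<Rightarrow> complex" where
  "corr s = prim s - prim (- cnj s)"

text \<open>The differential at \<open>s\<close> of the correction built from the density \<open>k\<close>.\<close>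

definition dcorr :: "(complex \<Rightarrow> complex) \<Rightarrow> complex \<Rightarrow> complex \<Rightarrow> complex" where
  "dcorr k s v = k (exp s) * v + cnj (k (exp (- s)) * v)"

lemma has_derivative_corr:
  assumes "s \<in> strip" shows "(corr has_derivative dcorr dens s) (at s)"
proof -
  have "(prim has_derivative (\<lambda>v. dens (exp s) * v)) (at s)"
    using has_field_derivative_prim[OF assms] by (simp add: has_field_derivative_def)
  moreover have "((\<lambda>s. prim (- cnj s)) has_derivative (\<lambda>v. dens (exp (- cnj s)) * (- cnj v))) (at s)"
  proof (rule has_derivative_compose[where f = "\<lambda>s. - cnj s" and f' = "\<lambda>v. - cnj v"
        and g' = "\<lambda>v. dens (exp (- cnj s)) * v"])
    show "((\<lambda>s. - cnj s) has_derivative (\<lambda>v. - cnj v)) (at s)"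
      by (auto intro!: derivative_eq_intros bounded_linear.has_derivative[OF bounded_linear_cnj])
    show "(prim has_derivative (\<lambda>v. dens (exp (- cnj s)) * v)) (at (- cnj s))"
      using has_field_derivative_prim[of "- cnj s"] assms
      by (simp add: has_field_derivative_def strip_reflect)
  qed
  ultimately have "(corr has_derivative (\<lambda>v. dens (exp s) * v - dens (exp (- cnj s)) * (- cnj v))) (at s)"
    unfolding corr_def by (rule has_derivative_diff)
  moreover have "dens (exp (- cnj s)) = cnj (dens (exp (- s)))"
    using dens_cnj[of "exp (- s)"] assms by (simp add: exp_strip_iff strip_reflect exp_cnj)
  ultimately show ?thesis by (simp add: dcorr_def[abs_def])
qed

lemma corr_imaginary: "Re s = 0 \<Longrightarrow> corr s = 0"
proof -
  assume "Re s = 0"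
  then have "- cnj s = s" by (simp add: complex_eq_iff)
  then show "corr s = 0" by (simp add: corr_def)
qed

text \<open>A function is determined on the strip by its differential and its value at \<open>0\<close>. Periodicity and
  reality of the correction are read off from this.\<close>

lemma corr_unique:
  assumes "\<And>s. s \<in> strip \<Longrightarrow> (g has_derivative dcorr dens s) (at s)" "g 0 = 0" "s \<in> strip"
  shows "g s = corr s"
proof -
  have "g s - corr s = g 0 - corr 0"
  proof (rule has_derivative_zero_unique[where f = "\<lambda>s. g s - corr s", OF convex_strip _ \<open>s \<in> strip\<close>])
    show "((\<lambda>s. g s - corr s) has_derivative (\<lambda>h. 0)) (at x within strip)" if "x \<in> strip" for x
      using has_derivative_diff[OF assms(1)[OF that] has_derivative_corr[OF that]]
      by (simp add: has_derivative_at_withinI)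
  qed (simp add: zero_strip)
  then show ?thesis using assms(2) corr_imaginary[of 0] by simp
qed

text \<open>The translate has the same differential, and both vanish on the imaginary axis. Thus the primitive
  \<open>prim\<close> may have a period, but \<open>corr\<close> descends to the annulus.\<close>

lemma corr_periodic:
  assumes "s \<in> strip" shows "corr (s + of_int n * (2 * of_real pi * \<i>)) = corr s"
proof -
  define c where "c = of_int n * (2 * of_real pi * \<i>)"
  have Re_c: "Re c = 0" by (simp add: c_def)
  have e: "exp c = 1" by (auto simp: exp_eq_1 c_def)
  have "((\<lambda>s. corr (s + c)) has_derivative dcorr dens s) (at s)" if s: "s \<in> strip" for s
  proof -
    have "((\<lambda>s. corr (s + c)) has_derivative dcorr dens (s + c)) (at s)"
      using s Re_c by (intro has_derivative_compose[where f = "\<lambda>s. s + c", OF _ has_derivative_corr]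
        derivative_eq_intros) (auto simp: strip_def)
    moreover have "dcorr dens (s + c) = dcorr dens s"
      using e by (simp add: dcorr_def[abs_def] exp_add exp_diff)
    ultimately show ?thesis by simp
  qed
  then have "corr (s + c) = corr s"
    by (rule corr_unique[where g = "\<lambda>s. corr (s + c)"]) (use assms Re_c corr_imaginary in auto)
  then show ?thesis by (simp add: c_def)
qed

lemma corr_cnj: assumes "s \<in> strip" shows "corr (cnj s) = cnj (corr s)"
proof -
  have "((\<lambda>s. cnj (corr (cnj s))) has_derivative dcorr dens s) (at s)" if s: "s \<in> strip" for s
  proof -
    have "((\<lambda>s. corr (cnj s)) has_derivative (\<lambda>v. dcorr dens (cnj s) (cnj v))) (at s)"
      using s by (intro has_derivative_compose[where f = cnj, OF _ has_derivative_corr]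
        bounded_linear.has_derivative[OF bounded_linear_cnj] has_derivative_ident) (auto simp: strip_reflect)
    from bounded_linear.has_derivative[OF bounded_linear_cnj this]
    have "((\<lambda>s. cnj (corr (cnj s))) has_derivative (\<lambda>v. cnj (dcorr dens (cnj s) (cnj v)))) (at s)" .
    moreover have "dens (cnj (exp s)) = cnj (dens (exp s))" "dens (cnj (exp (- s))) = cnj (dens (exp (- s)))"
      using s by (auto intro!: dens_cnj simp: exp_strip_iff strip_reflect)
    then have "(\<lambda>v. cnj (dcorr dens (cnj s) (cnj v))) = dcorr dens s"
      by (simp add: dcorr_def[abs_def] exp_cnj exp_minus)
    ultimately show ?thesis by simp
  qed
  then have "cnj (corr (cnj s)) = corr s"
    by (rule corr_unique[where g = "\<lambda>s. cnj (corr (cnj s))"]) (use assms corr_imaginary in auto)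
  then show ?thesis by (metis complex_cnj_cnj)
qed

lemma norm_dcorr_le:
  assumes "\<And>z. z \<in> collar \<Longrightarrow> norm (k z) \<le> B" "s \<in> strip"
  shows "norm (dcorr k s v) \<le> 2 * B * norm v"
proof -
  have "norm (dcorr k s v) \<le> norm (k (exp s)) * norm v + norm (k (exp (- s))) * norm v"
    unfolding dcorr_def by (rule order_trans[OF norm_triangle_ineq]) (simp add: norm_mult)
  also have "\<dots> \<le> B * norm v + B * norm v"
    using assms by (intro add_mono mult_right_mono) (auto simp: exp_strip_iff strip_reflect)
  finally show ?thesis by simp
qed

lemma corr_Lipschitz:
  assumes "s \<in> strip" "t \<in> strip" shows "norm (corr s - corr t) \<le> 840 * eps * norm (s - t)"
proof (rule differentiable_bound[OF convex_strip _ _ assms])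
  show "(corr has_derivative dcorr dens x) (at x within strip)" if "x \<in> strip" for x
    using has_derivative_corr[OF that] by (rule has_derivative_at_withinI)
  show "onorm (dcorr dens x) \<le> 840 * eps" if "x \<in> strip" for x
    using norm_dcorr_le[OF norm_dens_le that] by (intro onorm_le) auto
qed

lemma norm_corr_le:
  assumes "s \<in> strip" shows "norm (corr s) \<le> 1680 * eps"
proof -
  have "norm (corr s - corr (\<i> * of_real (Im s))) \<le> 840 * eps * norm (s - \<i> * of_real (Im s))"
    by (rule corr_Lipschitz[OF assms zero_strip]) simp
  also have "s - \<i> * of_real (Im s) = of_real (Re s)" by (simp add: complex_eq_iff)
  also have "norm (of_real (Re s) :: complex) \<le> 2"
    using assms ln_numerals by (simp add: strip_def)
  finally show ?thesis using corr_imaginary[of "\<i> * of_real (Im s)"] eps_pos by simp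
qed

text \<open>The correction for the leading term \<open>(2 z - 1)\<^sup>2 / (3 z)\<close> of \<open>dens z / eps\<close>.\<close>

definition corr1 :: "complex \<Rightarrow> complex" where
  "corr1 s = (4 * (exp s - exp (- cnj s)) + (exp (cnj s) - exp (- s)) - 8 * of_real (Re s)) / 3"

lemma has_derivative_corr1:
  "(corr1 has_derivative dcorr (\<lambda>z. (2 * z - 1)\<^sup>2 / (3 * z)) s) (at s)"
proof -
  have e: "((\<lambda>s. exp (f s)) has_derivative (\<lambda>v. exp (f s) * f' v)) (at s)"
    if "(f has_derivative f') (at s)" for f f' :: "complex \<Rightarrow> complex"
    using has_derivative_compose[OF that, of exp "\<lambda>v. exp (f s) * v"] DERIV_exp[of "f s"]
    by (simp add: has_field_derivative_def)
  have c: "(cnj has_derivative cnj) (at s)"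
    by (rule bounded_linear_imp_has_derivative[OF bounded_linear_cnj])
  have r: "((\<lambda>s. of_real (Re s) :: complex) has_derivative (\<lambda>v. of_real (Re v))) (at s)"
    by (intro bounded_linear_imp_has_derivative bounded_linear_intros
        bounded_linear_compose[OF bounded_linear_of_real bounded_linear_Re])
  have "(corr1 has_derivative (\<lambda>v. (4 * (exp s * v - exp (- cnj s) * (- cnj v))
      + (exp (cnj s) * cnj v - exp (- s) * (- v)) - 8 * of_real (Re v)) / 3)) (at s)"
    unfolding corr1_def
    by (intro bounded_linear.has_derivative[OF bounded_linear_divide] has_derivative_diff
        has_derivative_add has_derivative_mult_right e c r has_derivative_minus has_derivative_ident)
  moreover have "(\<lambda>v. (4 * (exp s * v - exp (- cnj s) * (- cnj v))
      + (exp (cnj s) * cnj v - exp (- s) * (- v)) - 8 * of_real (Re v)) / 3)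
      = dcorr (\<lambda>z. (2 * z - 1)\<^sup>2 / (3 * z)) s"
  proof
    fix v
    have r: "8 * of_real (Re v) = 4 * v + 4 * cnj v" by (simp add: complex_eq_iff)
    have k: "(2 * exp t - 1)\<^sup>2 / (3 * exp t) = (4 * exp t - 4 + exp (- t)) / 3" for t :: complex
      by (simp add: exp_minus field_simps power2_eq_square)
    show "(4 * (exp s * v - exp (- cnj s) * (- cnj v))
      + (exp (cnj s) * cnj v - exp (- s) * (- v)) - 8 * of_real (Re v)) / 3
      = dcorr (\<lambda>z. (2 * z - 1)\<^sup>2 / (3 * z)) s v"
      unfolding r dcorr_def k by (simp add: exp_cnj field_simps)
  qed
  ultimately show ?thesis by simp
qed

text \<open>The difference vanishes on the imaginary axis and its differential is of order \<open>eps\<^sup>2\<close>.\<close>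

lemma corr_first_order:
  assumes s: "s \<in> strip" shows "norm (corr s - of_real eps * corr1 s) \<le> eps / 1000"
proof -
  define g where "g s = corr s - of_real eps * corr1 s" for s
  define k where "k z = dens z - of_real eps * ((2 * z - 1)\<^sup>2 / (3 * z))" for z
  have g: "(g has_derivative dcorr k x) (at x within strip)" if "x \<in> strip" for x
  proof -
    have "(g has_derivative (\<lambda>v. dcorr dens x v - of_real eps * dcorr (\<lambda>z. (2 * z - 1)\<^sup>2 / (3 * z)) x v)) (at x)"
      unfolding g_def[abs_def]
      by (intro has_derivative_diff has_derivative_mult_right has_derivative_corr that has_derivative_corr1)
    moreover have "(\<lambda>v. dcorr dens x v - of_real eps * dcorr (\<lambda>z. (2 * z - 1)\<^sup>2 / (3 * z)) x v) = dcorr k x"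
      by (rule ext) (simp add: dcorr_def k_def algebra_simps)
    ultimately show ?thesis by (simp add: has_derivative_at_withinI)
  qed
  have z: "Re (\<i> * of_real (Im s)) = 0" by simp
  have "norm (g s - g (\<i> * of_real (Im s))) \<le> 140000 * eps\<^sup>2 * norm (s - \<i> * of_real (Im s))"
  proof (rule differentiable_bound[OF convex_strip g _ s zero_strip[OF z]])
    show "onorm (dcorr k x) \<le> 140000 * eps\<^sup>2" if "x \<in> strip" for x
      using norm_dcorr_le[OF dens_first_order that, folded k_def] by (intro onorm_le) auto
  qed
  also have "s - \<i> * of_real (Im s) = of_real (Re s)" by (simp add: complex_eq_iff)
  also have "140000 * eps\<^sup>2 * norm (of_real (Re s) :: complex) \<le> 140000 * eps\<^sup>2 * 2"
    using s ln_numerals by (intro mult_left_mono) (auto simp: strip_def)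
  finally have "norm (g s - g (\<i> * of_real (Im s))) \<le> 280000 * eps\<^sup>2" by simp
  moreover have "g (\<i> * of_real (Im s)) = 0"
    using corr_imaginary[OF z] by (simp add: g_def corr1_def)
  ultimately have "norm (g s) \<le> 280000 * eps\<^sup>2" by simp
  also have "\<dots> \<le> eps / 1000" by (simp add: eps_def power2_eq_square)
  finally show ?thesis by (simp add: g_def)
qed

text \<open>The horizontal part \<open>F + cnj G\<close>, before scaling. By periodicity of \<open>corr\<close> the choice of the branch
  of the logarithm does not matter.\<close>

definition hor :: "complex \<Rightarrow> complex" where "hor z = mob z + corr (Ln z)"

lemma hor_exp: assumes "s \<in> strip" shows "hor (exp s) = mob (exp s) + corr s"
proof -
  have "exp (Ln (exp s)) = exp s" by simp
  then obtain n :: int where n: "Ln (exp s) = s + (of_int (2 * n) * pi) * \<i>"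
    unfolding exp_eq by blast
  then have "Ln (exp s) = s + of_int n * (2 * of_real pi * \<i>)" by simp
  then have "corr (Ln (exp s)) = corr s" using corr_periodic[OF assms, of n] by simp
  then show ?thesis by (simp add: hor_def)
qed

lemma Ln_strip: "z \<in> collar \<Longrightarrow> Ln z \<in> strip"
  using exp_strip_iff[of "Ln z"] collar_nonzero[of z] by simp

lemma norm_hor_minus_mob: "z \<in> collar \<Longrightarrow> norm (hor z - mob z) \<le> 1680 * eps"
  using norm_corr_le[OF Ln_strip] by (simp add: hor_def)

text \<open>The derivatives of \<open>F = mob + V\<close> and \<open>G\<close>, where \<open>cnj (G z) = - V (1 / cnj z)\<close> up to a constant.\<close>

definition F_deriv :: "complex \<Rightarrow> complex" where "F_deriv z = 3 / (z - 2)\<^sup>2 + dens z / z"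
definition G_deriv :: "complex \<Rightarrow> complex" where "G_deriv z = dens (1 / z) / z"

lemma F_deriv_eq: assumes "z \<in> collar" "z \<noteq> 2" shows "F_deriv z = 3 * fac z / (z - 2)\<^sup>2"
proof -
  have z: "z \<noteq> 0" using collar_nonzero[OF assms(1)] .
  have f: "fac z \<noteq> 0" by (rule fac_nonzero)
  have mu: "3 * z * mu z = - (2 * z - 1) * (z - 2)"
    using z by (simp add: mu_def field_simps power2_eq_square)
  have "9 * z\<^sup>2 * (fac z * (fac z - 1)) = of_real eps * (3 * z * mu z)\<^sup>2"
    using fac_quadratic[of z] by (simp add: power2_eq_square algebra_simps)
  also have "\<dots> = of_real eps * ((2 * z - 1)\<^sup>2 * (z - 2)\<^sup>2)"
    unfolding mu by (simp add: power_mult_distrib power2_eq_square algebra_simps)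
  finally have *: "of_real eps * (2 * z - 1)\<^sup>2 = 9 * z\<^sup>2 * (fac z * (fac z - 1)) / (z - 2)\<^sup>2"
    using assms(2) by (simp add: field_simps)
  define y where "y = (z - 2)\<^sup>2"
  have y: "y \<noteq> 0" using assms(2) by (simp add: y_def)
  have "dens z / z = 3 * (fac z - 1) / (z - 2)\<^sup>2"
    unfolding dens_def * y_def[symmetric] using z f y by (simp add: field_simps power2_eq_square)
  then show ?thesis by (simp add: F_deriv_def add_divide_distrib[symmetric] algebra_simps)
qed

lemma G_deriv_eq: assumes "z \<in> collar" "z \<noteq> 2" shows "G_deriv z = of_real eps * (z - 2)\<^sup>2 / (3 * z\<^sup>2 * fac z)"
proof -
  have z: "z \<noteq> 0" using collar_nonzero[OF assms(1)] .
  have "(2 * (1 / z) - 1)\<^sup>2 = (z - 2)\<^sup>2 / z\<^sup>2"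
    using z by (simp add: power2_eq_square field_simps)
  then show ?thesis
    using z fac_nonzero[of z] by (simp add: G_deriv_def dens_def fac_inverse power2_eq_square field_simps)
qed

text \<open>The factors \<open>fac\<close> cancel: this is what the quadratic equation for \<open>fac\<close> is designed for.\<close>

lemma F_deriv_G_deriv: assumes "z \<in> collar" "z \<noteq> 2" shows "F_deriv z * G_deriv z = of_real eps / z\<^sup>2"
  using fac_nonzero[of z] assms(2) by (simp add: F_deriv_eq[OF assms] G_deriv_eq[OF assms])

lemma norm_F_deriv_ge: assumes "z \<in> collar" "z \<noteq> 2" shows "norm (F_deriv z) \<ge> 3 / 2 / (norm (z - 2))\<^sup>2"
  using norm_fac_ge[of z] assms(2)
  by (simp add: F_deriv_eq[OF assms] norm_divide norm_mult norm_power divide_simps)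

lemma norm_G_deriv_le: assumes "z \<in> collar" shows "norm (G_deriv z) \<le> 2100 * eps"
proof -
  have "norm (G_deriv z) = norm (dens (1 / z)) * norm (1 / z)" by (simp add: G_deriv_def norm_divide)
  also have "\<dots> \<le> (420 * eps) * 5"
    using norm_dens_le[OF collar_inverse[OF assms]] collar_inverse[OF assms] eps_pos
    by (intro mult_mono) (auto simp: collar_def)
  finally show ?thesis by simp
qed

lemma norm_G_deriv_less_F_deriv: assumes "z \<in> collar" "z \<noteq> 2" shows "norm (G_deriv z) < norm (F_deriv z)"
proof -
  have "norm (z - 2) \<le> 7" using assms(1) norm_triangle_ineq4[of z 2] by (simp add: collar_def)
  then have "(norm (z - 2))\<^sup>2 \<le> 7\<^sup>2" by (intro power_mono) auto
  then have "3 / 2 / 49 \<le> 3 / 2 / (norm (z - 2))\<^sup>2"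
    using assms(2) by (intro divide_left_mono) auto
  then show ?thesis using norm_F_deriv_ge[OF assms] norm_G_deriv_le[OF assms(1)] by (simp add: eps_def)
qed

lemma holomorphic_F_deriv: "F_deriv holomorphic_on collar - {2}"
  unfolding F_deriv_def using collar_nonzero
  by (intro holomorphic_intros holomorphic_on_subset[OF holomorphic_on_dens]) auto

lemma holomorphic_G_deriv: "G_deriv holomorphic_on collar - {2}"
proof -
  have "(dens \<circ> (\<lambda>z. 1 / z)) holomorphic_on collar - {2}"
    by (rule holomorphic_on_compose_gen[OF _ holomorphic_on_dens])
      (use collar_inverse collar_nonzero in \<open>auto intro!: holomorphic_intros\<close>)
  then show ?thesis
    unfolding G_deriv_def using collar_nonzero by (auto intro!: holomorphic_intros simp: o_def)
qed

text \<open>A branch of the logarithm that is holomorphic near \<open>z0\<close>, also when \<open>z0\<close> is on the negative real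
  axis.\<close>

definition branch :: "complex \<Rightarrow> complex \<Rightarrow> complex" where
  "branch z0 z = Ln (z / z0) + Ln z0"

lemma branch_at:
  assumes z0: "z0 \<noteq> 0"
  shows "(branch z0 has_derivative (\<lambda>v. v / z0)) (at z0)" "branch z0 z0 = Ln z0"
    "z \<noteq> 0 \<Longrightarrow> exp (branch z0 z) = z" "z \<noteq> 0 \<Longrightarrow> Re (branch z0 z) = ln (norm z)"
proof -
  have "(branch z0 has_field_derivative 1 / z0) (at z0)"
    unfolding branch_def[abs_def] using z0 by (auto intro!: derivative_eq_intros)
  moreover have "(*) (1 / z0) = (\<lambda>v. v / z0)" by (rule ext) simp
  ultimately show "(branch z0 has_derivative (\<lambda>v. v / z0)) (at z0)"
    by (simp add: has_field_derivative_def)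
  show "branch z0 z0 = Ln z0" using z0 by (simp add: branch_def)
  show "exp (branch z0 z) = z" if "z \<noteq> 0" using that z0 by (simp add: branch_def exp_add)
  show "Re (branch z0 z) = ln (norm z)" if "z \<noteq> 0"
    using that z0 by (simp add: branch_def norm_divide ln_div)
qed

lemma has_derivative_hor:
  assumes "z \<in> collar" "z \<noteq> 2"
  shows "(hor has_derivative (\<lambda>v. F_deriv z * v + cnj (G_deriv z * v))) (at z)"
proof -
  have z: "z \<noteq> 0" using collar_nonzero[OF assms(1)] .
  define L where "L = branch z"
  note L = branch_at[OF z, folded L_def]
  have "((\<lambda>w. corr (L w)) has_derivative (\<lambda>v. dcorr dens (Ln z) (v / z))) (at z)"
    by (rule has_derivative_compose[where f = L and f' = "\<lambda>v. v / z" and g' = "dcorr dens (Ln z)", OF L(1)])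
      (use has_derivative_corr[OF Ln_strip[OF assms(1)]] L(2) in simp)
  moreover have "(mob has_field_derivative 3 / (z - 2)\<^sup>2) (at z)"
    unfolding mob_def using assms(2)
    by (auto intro!: derivative_eq_intros simp: power2_eq_square field_simps)
  then have "(mob has_derivative (\<lambda>v. 3 / (z - 2)\<^sup>2 * v)) (at z)"
    by (simp only: has_field_derivative_def)
  ultimately have "((\<lambda>w. mob w + corr (L w)) has_derivative
      (\<lambda>v. 3 / (z - 2)\<^sup>2 * v + dcorr dens (Ln z) (v / z))) (at z)"
    by (intro has_derivative_add)
  moreover have "(\<lambda>v. 3 / (z - 2)\<^sup>2 * v + dcorr dens (Ln z) (v / z)) = (\<lambda>v. F_deriv z * v + cnj (G_deriv z * v))"
    using z by (intro ext) (simp add: dcorr_def F_deriv_def G_deriv_def exp_minus inverse_eq_divide algebra_simps)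
  ultimately have "((\<lambda>w. mob w + corr (L w)) has_derivative (\<lambda>v. F_deriv z * v + cnj (G_deriv z * v))) (at z)"
    by simp
  then show ?thesis
  proof (rule has_derivative_transform_within_open[OF _ open_collar assms(1)])
    fix w assume w: "w \<in> collar"
    then have "w \<noteq> 0" by (rule collar_nonzero)
    then show "mob w + corr (L w) = hor w"
      using hor_exp[of "L w"] L(3)[of w] w exp_strip_iff[of "L w"] by simp
  qed
qed

section \<open>The maximal surface and its planar end\<close>

text \<open>The scale for which \<open>4 * scal\<^sup>2 * eps / z\<^sup>2\<close> is the square of \<open>h' z = - 1 / (ln 2 * z)\<close>, that is for
  which the height takes the values \<open>1\<close> on \<open>norm z = 1\<close> and \<open>-1\<close> on \<open>norm z = 4\<close>.\<close>

definition scal :: real where "scal = 1 / (2 * sqrt eps * ln 2)"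

definition surf :: "complex \<Rightarrow> real^3" where
  "surf z = pt (of_real scal * hor z) (1 - ln (norm z) / ln 2)"

lemma scal_pos: "scal > 0" using eps_pos by (simp add: scal_def)

lemma surf_data:
  "weierstrass_data surf (collar - {2}) (\<lambda>z. of_real scal * F_deriv z) (\<lambda>z. of_real scal * G_deriv z)
     (\<lambda>z. - 1 / (of_real (ln 2) * z))"
  unfolding weierstrass_data_def
proof (intro conjI ballI)
  show "open (collar - {2})" using open_collar by (simp add: open_delete)
  show "(\<lambda>z. of_real scal * F_deriv z) holomorphic_on collar - {2}"
    "(\<lambda>z. of_real scal * G_deriv z) holomorphic_on collar - {2}"
    by (intro holomorphic_intros holomorphic_F_deriv holomorphic_G_deriv)+
  show "(\<lambda>z. - 1 / (of_real (ln 2) * z)) holomorphic_on collar - {2}"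
    using collar_nonzero by (intro holomorphic_intros) auto
next
  fix z assume "z \<in> collar - {2}"
  then have z: "z \<in> collar" "z \<noteq> 2" "z \<noteq> 0" using collar_nonzero by auto
  define L where "L = branch z"
  note L = branch_at[OF z(3), folded L_def]
  have "((\<lambda>w. 1 - Re (L w) / ln 2) has_derivative (\<lambda>v. 0 - Re (v / z) / ln 2)) (at z)"
    by (intro has_derivative_diff has_derivative_const bounded_linear.has_derivative[OF bounded_linear_divide]
        bounded_linear.has_derivative[OF bounded_linear_Re] L(1))
  then have "((\<lambda>w. 1 - ln (norm w) / ln 2) has_derivative (\<lambda>v. 0 - Re (v / z) / ln 2)) (at z)"
    by (rule has_derivative_transform_within_open[OF _ open_collar z(1)])
      (use L(4) collar_nonzero in auto)
  moreover have "(\<lambda>v. 0 - Re (v / z) / ln 2) = (\<lambda>v. Re (- 1 / (of_real (ln 2) * z) * v))"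
  proof
    fix v
    have "- 1 / (of_real (ln 2) * z) * v = (- 1 / ln 2) *\<^sub>R (v / z)"
      by (simp add: scaleR_conv_of_real)
    then show "0 - Re (v / z) / ln 2 = Re (- 1 / (of_real (ln 2) * z) * v)"
      by (simp only: scaleR_complex.sel) simp
  qed
  moreover have "((\<lambda>w. of_real scal * hor w) has_derivative
      (\<lambda>v. of_real scal * F_deriv z * v + cnj (of_real scal * G_deriv z * v))) (at z)"
    using has_derivative_mult_right[OF has_derivative_hor[OF z(1,2)], of "of_real scal"]
    by (simp add: algebra_simps)
  ultimately show "(surf has_derivative (\<lambda>v. pt (of_real scal * F_deriv z * v + cnj (of_real scal * G_deriv z * v))
      (Re (- 1 / (of_real (ln 2) * z) * v)))) (at z)"
    unfolding surf_def by (intro has_derivative_pt) auto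
qed

lemma surf_null:
  assumes "z \<in> collar - {2}"
  shows "(- 1 / (of_real (ln 2) * z))\<^sup>2 = 4 * (of_real scal * F_deriv z) * (of_real scal * G_deriv z)"
proof -
  have "4 * (of_real scal * F_deriv z) * (of_real scal * G_deriv z) = of_real (4 * scal\<^sup>2) * (F_deriv z * G_deriv z)"
    by (simp add: power2_eq_square)
  also have "\<dots> = of_real (4 * scal\<^sup>2 * eps) / z\<^sup>2"
    using F_deriv_G_deriv[of z] assms by simp
  also have "4 * scal\<^sup>2 * eps = 1 / (ln 2)\<^sup>2"
    using eps_pos by (simp add: scal_def power_mult_distrib power_divide)
  finally show ?thesis by (simp add: power_mult_distrib power_divide)
qed

lemma surf_maximal: "K \<subseteq> collar - {2} \<Longrightarrow> maximal_surface surf K"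
proof (rule weierstrass_data_maximal[OF surf_data surf_null])
  show "norm (of_real scal * F_deriv z) \<noteq> norm (of_real scal * G_deriv z)" if "z \<in> collar - {2}" for z
    using norm_G_deriv_less_F_deriv[of z] that scal_pos by (simp add: norm_mult)
qed

text \<open>The end model is \<open>\<alpha> / cnj z\<close>, whereas \<open>mob\<close> has a pole in \<open>z\<close>; hence the conjugation. The factor
  keeps the image of the unit disk within the open annulus.\<close>

definition chart :: "complex \<Rightarrow> complex" where "chart z = 2 + (1 / 2) * cnj z"

lemma chart_collar:
  assumes "z \<in> ball 0 1" shows "norm (chart z) < 4" "1 < norm (chart z)" "Re (chart z) > 0" "chart z \<in> collar"
    and "z \<noteq> 0 \<Longrightarrow> chart z \<noteq> 2"
proof -
  have n: "norm ((1 / 2) * cnj z) < 1 / 2" using assms by (simp add: norm_mult)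
  show 1: "norm (chart z) < 4" using n norm_triangle_ineq[of 2 "(1 / 2) * cnj z"] by (simp add: chart_def)
  show 2: "1 < norm (chart z)" using n norm_diff_ineq[of 2 "(1 / 2) * cnj z"] by (simp add: chart_def)
  show "Re (chart z) > 0" using n abs_Re_le_cmod[of "(1 / 2) * cnj z"] by (simp add: chart_def)
  show "chart z \<in> collar" using 1 2 by (simp add: collar_def)
  show "chart z \<noteq> 2" if "z \<noteq> 0" using that by (simp add: chart_def)
qed

lemma dder_affine_cnj: "dder v (\<lambda>z. a + b * cnj z) z = b * cnj v"
proof -
  have "((\<lambda>z. a + b * cnj z) has_derivative (\<lambda>v. b * cnj v)) (at z)"
    by (auto intro!: derivative_eq_intros bounded_linear.has_derivative[OF bounded_linear_cnj])
  then show ?thesis unfolding dder_def by (metis frechet_derivative_at)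
qed

lemma Cinf_on_affine_cnj: "Cinf_on (\<lambda>z. a + b * cnj z) S"
proof -
  have "Ck_on k (\<lambda>z. a + b * cnj z) S" for k a b
  proof (induction k arbitrary: a b)
    case (Suc k)
    have "(\<lambda>z. a + b * cnj z) differentiable at z" for z
      unfolding differentiable_def
      by (rule exI[of _ "\<lambda>v. b * cnj v"])
        (auto intro!: derivative_eq_intros bounded_linear.has_derivative[OF bounded_linear_cnj])
    moreover have "dder v (\<lambda>z. a + b * cnj z) = (\<lambda>z. b * cnj v + 0 * cnj z)" for v
      by (rule ext) (simp add: dder_affine_cnj)
    then have "Ck_on k (dder v (\<lambda>z. a + b * cnj z)) S" for v
      by (simp only: Suc)
    ultimately show ?case by simp
  qed (auto intro!: continuous_intros)
  then show ?thesis by (simp add: Cinf_on_def)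
qed

lemma mob_diff:
  assumes "z \<noteq> 2" "z' \<noteq> 2" shows "mob z - mob z' = 3 * (z - z') / ((z - 2) * (z' - 2))"
  using assms by (simp add: mob_def field_simps)

text \<open>Distances in the logarithmic coordinate are controlled by distances in the annulus. Near \<open>1\<close> this is
  the usual estimate for the logarithm; away from \<open>1\<close> the logarithm is bounded because \<open>u\<close> stays away
  from \<open>0\<close>.\<close>

lemma norm_Ln_le_norm_minus_one:
  assumes "1 / 4 \<le> norm u" shows "norm (Ln u) \<le> 20 * norm (u - 1)"
proof (cases "norm (u - 1) < 1 / 2")
  case True
  then show ?thesis using norm_Ln_le[of "u - 1"] norm_ge_zero[of "u - 1"] by (simp del: norm_ge_zero)
next
  case False
  have u: "u \<noteq> 0" using assms by auto
  have "ln (norm u) \<le> norm u - 1" using u by (intro ln_le_minus_one) auto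
  moreover have "norm u \<le> norm (u - 1) + 1" using norm_triangle_ineq[of "u - 1" 1] by simp
  moreover have "- ln (norm u) \<le> 2"
  proof -
    have "ln (1 / 4) \<le> ln (norm u)" using assms by (intro ln_mono) auto
    then show ?thesis using ln_numerals by (simp add: ln_div)
  qed
  ultimately have "\<bar>ln (norm u)\<bar> \<le> 4 * norm (u - 1)" using False by linarith
  moreover have "\<bar>Im (Ln u)\<bar> \<le> pi" using mpi_less_Im_Ln[OF u] Im_Ln_le_pi[OF u] by linarith
  then have "\<bar>Im (Ln u)\<bar> \<le> 8 * norm (u - 1)" using False pi_less_4 by linarith
  moreover have "norm (Ln u) \<le> \<bar>Re (Ln u)\<bar> + \<bar>Im (Ln u)\<bar>" by (rule cmod_le)
  ultimately show ?thesis using u by simp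
qed

text \<open>If \<open>hor z = hor z'\<close>, then \<open>mob z - mob z'\<close> is a difference of corrections and therefore at most
  \<open>16800 * eps * norm (z - z')\<close>; but on the annulus it is at least
  \<open>3 / 36 * norm (z - z')\<close>, because \<open>norm (z - 2) \<le> 6\<close> there.\<close>

lemma inj_on_hor: "inj_on hor ({z. 1 \<le> norm z \<and> norm z \<le> 4} - {2})"
proof (rule inj_onI, rule ccontr)
  fix z z' assume "z \<in> {z. 1 \<le> norm z \<and> norm z \<le> 4} - {2}" "z' \<in> {z. 1 \<le> norm z \<and> norm z \<le> 4} - {2}"
    and eq: "hor z = hor z'" and ne: "z \<noteq> z'"
  then have z: "1 \<le> norm z" "norm z \<le> 4" "z \<noteq> 2" and z': "1 \<le> norm z'" "norm z' \<le> 4" "z' \<noteq> 2" by auto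
  have zc: "z \<in> collar" "z \<noteq> 0" and zc': "z' \<in> collar" "z' \<noteq> 0" using z z' by (auto simp: collar_def)
  (* The logarithm of z' that is close to Ln z when z' is close to z, even across the branch cut. *)
  define s where "s = Ln z + Ln (z' / z)"
  have es: "exp s = z'" using zc zc' by (simp add: s_def exp_add)
  then have s: "s \<in> strip" using zc' exp_strip_iff[of s] by simp
  have "mob z - mob z' = corr s - corr (Ln z)"
    using eq hor_exp[OF s] es by (simp add: hor_def algebra_simps)
  also have "norm (corr s - corr (Ln z)) \<le> 840 * eps * norm (s - Ln z)"
    by (rule corr_Lipschitz[OF s Ln_strip[OF zc(1)]])
  also have "s - Ln z = Ln (z' / z)" by (simp add: s_def)
  also have "norm (Ln (z' / z)) \<le> 20 * norm (z' / z - 1)"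
  proof (rule norm_Ln_le_norm_minus_one)
    have "norm z \<le> 4 * norm z'" using z z' by linarith
    then show "1 / 4 \<le> norm (z' / z)" using zc by (simp add: norm_divide field_simps)
  qed
  also have "z' / z - 1 = (z' - z) / z" using zc by (simp add: field_simps)
  also have "norm ((z' - z) / z) \<le> norm (z' - z)"
    using z by (simp add: norm_divide divide_le_eq mult_left_mono[of 1 "norm z" "norm (z' - z)", simplified])
  finally have up: "norm (mob z - mob z') \<le> 840 * eps * (20 * norm (z' - z))"
    using eps_pos by simp
  have "norm (z - 2) \<le> 6" "norm (z' - 2) \<le> 6"
    using z z' norm_triangle_ineq4[of z 2] norm_triangle_ineq4[of z' 2] by auto
  then have "norm (z - 2) * norm (z' - 2) \<le> 6 * 6" by (intro mult_mono) auto
  then have "3 * norm (z - z') / 36 \<le> 3 * norm (z - z') / (norm (z - 2) * norm (z' - 2))"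
    using z z' by (intro divide_left_mono) auto
  also have "\<dots> = norm (mob z - mob z')"
    by (simp only: mob_diff[OF z(3) z'(3)] norm_divide norm_mult norm_numeral)
  finally have "3 * norm (z - z') / 36 \<le> 16800 * eps * norm (z - z')"
    using up by (simp add: norm_minus_commute)
  moreover have "norm (z - z') > 0" using ne by simp
  ultimately show False by (simp add: eps_def)
qed

lemma inj_on_surf: "inj_on surf ({z. 1 \<le> norm z \<and> norm z \<le> 4} - {2})"
  using inj_on_hor scal_pos by (auto simp: inj_on_def surf_def)

lemma end_model_eq: "z \<noteq> 0 \<Longrightarrow> end_model \<alpha> 0 z = pt (of_real \<alpha> / cnj z) 0"
proof -
  assume z: "z \<noteq> 0"
  have a: "cos (Arg z) = Re z / norm z" "sin (Arg z) = Im z / norm z"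
    using Re_rcis[of "norm z" "Arg z"] Im_rcis[of "norm z" "Arg z"] z by (simp_all add: rcis_cmod_Arg field_simps)
  have "of_real \<alpha> / cnj z = of_real (\<alpha> / (norm z)\<^sup>2) * z"
    using z complex_norm_square[of z] by (simp add: field_simps power2_eq_square)
  then show ?thesis
    unfolding end_model_def a by (simp add: vec_eq_iff forall_3 power2_eq_square)
qed

text \<open>The correction is continuous at the puncture, so the end differs from the pole
  \<open>- 6 / cnj z\<close> of \<open>mob\<close> in this chart by a function with a limit. The normal becomes vertical because
  \<open>F'\<close> has a double pole while \<open>G'\<close> stays bounded.\<close>

lemma planar_end_surf: "planar_end (surf \<circ> chart)"
proof -
  define B where "B = ball (0::complex) 1 - {0}"
  have sub: "2 + 1 / 2 * cnj z \<in> collar - {2}" if "z \<in> B" for z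
    using chart_collar[of z] that by (auto simp: B_def chart_def)
  have oB: "open B" by (simp add: B_def open_delete)
  define F where "F z = cnj (1 / 2 * (of_real scal * G_deriv (2 + 1 / 2 * cnj z)))" for z
  define G where "G z = cnj (1 / 2 * (of_real scal * F_deriv (2 + 1 / 2 * cnj z)))" for z
  define h where "h z = cnj (1 / 2 * (- 1 / (of_real (ln 2) * (2 + 1 / 2 * cnj z))))" for z
  have D: "weierstrass_data (surf \<circ> chart) B F G h"
    using weierstrass_data_reflected_affine[OF surf_data oB sub]
    unfolding F_def G_def h_def chart_def by blast
  have null: "(h z)\<^sup>2 = 4 * F z * G z" if "z \<in> B" for z
  proof -
    define q where "q = 2 + 1 / 2 * cnj z"
    define c where "c = - 1 / (of_real (ln 2) * q)"
    have "(h z)\<^sup>2 = (cnj (1 / 2 * c))\<^sup>2" by (simp only: h_def c_def q_def)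
    also have "\<dots> = cnj ((1 / 2)\<^sup>2 * c\<^sup>2)" by (simp add: power2_eq_square)
    also have "\<dots> = 4 * F z * G z"
      unfolding surf_null[OF sub[OF that], folded q_def, folded c_def] F_def G_def q_def[symmetric]
      by (simp add: power2_eq_square)
    finally show ?thesis .
  qed
  have FG: "norm (F z) < norm (G z)" if "z \<in> B" for z
    using norm_G_deriv_less_F_deriv[of "2 + 1 / 2 * cnj z"] sub[OF that] scal_pos
    by (simp add: F_def G_def norm_mult)
  have "maximal_surface (surf \<circ> chart) B"
    using FG by (intro weierstrass_data_maximal[OF D null]) force+
  moreover have "inj_on (surf \<circ> chart) B"
  proof (rule comp_inj_on)
    show "inj_on chart B" by (auto simp: inj_on_def chart_def)
    show "inj_on surf (chart ` B)"
      by (rule inj_on_subset[OF inj_on_surf]) (use chart_collar in \<open>force simp: B_def\<close>)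
  qed
  moreover have "conformal_on (surf \<circ> chart) B"
    by (rule weierstrass_data_conformal[OF D null])
  moreover have "(unit_normal (surf \<circ> chart) \<longlongrightarrow> axis 3 1) (at 0)"
  proof (rule weierstrass_data_normal_limit[OF D null])
    show "G z \<noteq> 0" if "z \<in> B" for z using FG[OF that] by auto
    show ev: "eventually (\<lambda>z. z \<in> B) (at 0)"
      unfolding B_def eventually_at by (intro exI[of _ 1]) auto
    have "isCont (\<lambda>z. 350 * eps * (norm z)\<^sup>2) (0::complex)"
      by (intro continuous_intros)
    then have lim: "((\<lambda>z. 350 * eps * (norm (z::complex))\<^sup>2) \<longlongrightarrow> 0) (at 0)"
      by (simp add: isCont_def)
    have "norm (F z / G z) \<le> 350 * eps * (norm z)\<^sup>2" if "z \<in> B" for z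
    proof -
      define q where "q = 2 + 1 / 2 * cnj z"
      have q: "q \<in> collar" "q \<noteq> 2" "norm (q - 2) = norm z / 2"
        using sub[OF that] by (auto simp: q_def norm_mult)
      have z: "norm z > 0" using that by (simp add: B_def)
      have "norm (F z / G z) = norm (G_deriv q) / norm (F_deriv q)"
        using scal_pos by (simp add: F_def G_def q_def norm_divide norm_mult)
      also have "\<dots> \<le> (2100 * eps) / (3 / 2 / (norm (q - 2))\<^sup>2)"
        using norm_G_deriv_le[OF q(1)] norm_F_deriv_ge[OF q(1,2)] q(2) eps_pos by (intro frac_le) auto
      finally show ?thesis unfolding q(3) by (simp add: power_divide)
    qed
    then show "((\<lambda>z. F z / G z) \<longlongrightarrow> 0) (at 0)"
      by (intro Lim_null_comparison[OF eventually_mono[OF ev] lim]) auto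
  qed
  moreover have "\<exists>\<alpha> c. \<alpha> \<noteq> 0 \<and> ((\<lambda>z. (surf \<circ> chart) z - end_model \<alpha> 0 z) \<longlongrightarrow> c) (at 0)"
  proof (intro exI conjI)
    show "- 6 * scal \<noteq> 0" using scal_pos by simp
    have "eventually (\<lambda>z. pt (of_real scal * (- 2 + corr (Ln (chart z)))) (1 - ln (norm (chart z)) / ln 2)
        = (surf \<circ> chart) z - end_model (- 6 * scal) 0 z) (at 0)"
      unfolding eventually_at
    proof (intro exI[of _ 1] conjI ballI impI)
      fix z :: complex assume "z \<noteq> 0 \<and> dist z 0 < 1"
      then have z: "z \<noteq> 0" by simp
      have m: "mob (chart z) = - 2 - 6 / cnj z" using z by (simp add: mob_def chart_def field_simps)
      show "pt (of_real scal * (- 2 + corr (Ln (chart z)))) (1 - ln (norm (chart z)) / ln 2)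
        = (surf \<circ> chart) z - end_model (- 6 * scal) 0 z"
        unfolding o_apply end_model_eq[OF z] surf_def hor_def pt_diff pt_eq_iff m
        by (simp add: algebra_simps)
    qed simp
    moreover have "isCont (\<lambda>z. corr (Ln (chart z))) 0"
    proof -
      have "isCont corr (Ln (chart 0))"
        by (rule has_derivative_continuous[OF has_derivative_corr[OF Ln_strip]]) (use chart_collar[of 0] in auto)
      moreover have "isCont (\<lambda>z. Ln (chart z)) 0"
        unfolding chart_def by (intro continuous_intros) (auto simp: complex_nonpos_Reals_iff)
      ultimately show ?thesis by (rule isCont_o2[rotated])
    qed
    then have "((\<lambda>z. pt (of_real scal * (- 2 + corr (Ln (chart z)))) (1 - ln (norm (chart z)) / ln 2))
        \<longlongrightarrow> pt (of_real scal * (- 2 + corr (Ln (chart 0)))) (1 - ln (norm (chart 0)) / ln 2)) (at 0)"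
      unfolding isCont_def
      by (intro tendsto_pt tendsto_intros) (auto simp: chart_def intro!: tendsto_eq_intros)
    ultimately show "((\<lambda>z. (surf \<circ> chart) z - end_model (- 6 * scal) 0 z)
        \<longlongrightarrow> pt (of_real scal * (- 2 + corr (Ln (chart 0)))) (1 - ln (norm (chart 0)) / ln 2)) (at 0)"
      by (rule Lim_transform_eventually[rotated])
  qed
  ultimately show ?thesis unfolding planar_end_def B_def by blast
qed

lemma surf_annulus: "maximal_annulus_planar_end (-1) 1 1 4 2 surf"
  unfolding maximal_annulus_planar_end_def
proof (intro conjI)
  show "maximal_surface surf (punctured_annulus 1 4 2)"
    by (rule surf_maximal) (auto simp: punctured_annulus_def collar_def)
  show "has_planar_end_at surf {z. 1 < norm z \<and> norm z < 4} 2"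
    unfolding has_planar_end_at_def
  proof (intro exI[of _ chart] conjI ballI allI impI)
    show "chart 0 = 2" by (simp add: chart_def)
    show "continuous_on (ball 0 1) chart" unfolding chart_def by (intro continuous_intros)
    show "inj_on chart (ball 0 1)" by (auto simp: inj_on_def chart_def)
    show "chart ` ball 0 1 \<subseteq> {z. 1 < norm z \<and> norm z < 4}" using chart_collar by blast
    show "Cinf_on chart (ball 0 1 - {0})" unfolding chart_def by (rule Cinf_on_affine_cnj)
    show "dder v chart z \<noteq> 0" if "v \<noteq> 0" for z v
      unfolding chart_def[abs_def] dder_affine_cnj using that by simp
    show "planar_end (surf \<circ> chart)" by (rule planar_end_surf)
  qed
  show "surf ` punctured_annulus 1 4 2 \<subseteq> slab (- 1) 1"
  proof
    fix x assume "x \<in> surf ` punctured_annulus 1 4 2"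
    then obtain z where z: "1 \<le> norm z" "norm z \<le> 4" and x: "x = surf z"
      by (auto simp: punctured_annulus_def)
    then have "0 < norm z" by linarith
    then have "0 \<le> ln (norm z)" "ln (norm z) \<le> ln 4" using z by simp_all
    then show "x \<in> slab (- 1) 1"
      using ln_numerals(1,2) by (simp add: x slab_def surf_def divide_le_eq)
  qed
  show "surf ` sphere 0 1 \<subseteq> hplane 1 \<and> surf ` sphere 0 4 \<subseteq> hplane (- 1) \<or>
    surf ` sphere 0 1 \<subseteq> hplane (- 1) \<and> surf ` sphere 0 4 \<subseteq> hplane 1"
    using ln_numerals(1,2) by (intro disjI1) (auto simp: hplane_def surf_def)
qed auto

section \<open>The inner boundary and the level curves\<close>

lemma surf_unit: assumes "norm z = 1" shows "surf z = pt (of_real scal * mob z) 1"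
proof -
  have "z \<noteq> 0" using assms by auto
  then have "corr (Ln z) = 0" using assms by (intro corr_imaginary) simp
  then show ?thesis using assms by (simp add: surf_def hor_def)
qed

lemma surf_outer: "norm z = 4 \<Longrightarrow> surf z = pt (of_real scal * hor z) (- 1)"
  using ln_numerals(1,2) by (simp add: surf_def)

lemma norm_reflect_2: "norm (1 + 2 * \<zeta>) = norm (\<zeta> + 2)" if "norm \<zeta> = 1" for \<zeta> :: complex
proof -
  have "(Re \<zeta>)\<^sup>2 + (Im \<zeta>)\<^sup>2 = 1"
    using that by (simp flip: cmod_power2)
  then have "(norm (1 + 2 * \<zeta>))\<^sup>2 = (norm (\<zeta> + 2))\<^sup>2"
    unfolding cmod_power2 by (simp add: power2_eq_square algebra_simps)
  then show ?thesis by simp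
qed

lemma mob_unit_circle: "mob ` sphere 0 1 = sphere 0 1"
proof (intro equalityI subsetI)
  fix w assume "w \<in> mob ` sphere 0 1"
  then obtain z where z: "norm z = 1" "w = mob z" by auto
  have "norm (1 - 2 * z) = norm (z - 2)"
    using norm_reflect_2[of "- z"] z by (simp add: norm_minus_commute[of z 2])
  moreover have "z \<noteq> 2" using z by auto
  ultimately show "w \<in> sphere 0 1" by (simp add: z mob_def norm_divide)
next
  fix w :: complex assume "w \<in> sphere 0 1"
  then have w: "norm w = 1" by simp
  have w2: "w + 2 \<noteq> 0" using w by (auto simp: add_eq_0_iff2)
  define z where "z = (1 + 2 * w) / (w + 2)"
  have "norm z = 1" using norm_reflect_2[OF w] w2 by (simp add: z_def norm_divide)
  moreover have "1 - 2 * z = - 3 * w / (w + 2)" "z - 2 = - 3 / (w + 2)"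
    using w2 by (simp_all add: z_def field_simps)
  then have "mob z = w" using w2 by (simp add: mob_def)
  ultimately show "w \<in> mob ` sphere 0 1" by auto
qed

lemma inner_boundary_circle: "circle_in 1 (surf ` sphere 0 1)"
  unfolding circle_in_def
proof (intro exI conjI)
  show "pt 0 1 \<in> hplane 1" by (simp add: hplane_def)
  show "0 < scal" by (rule scal_pos)
  show "surf ` sphere 0 1 = sphere (pt 0 1) scal \<inter> hplane 1"
  proof (intro equalityI subsetI)
    fix x assume "x \<in> surf ` sphere 0 1"
    then obtain z where z: "norm z = 1" "x = surf z" by auto
    then have "norm (mob z) = 1" using mob_unit_circle by auto
    then show "x \<in> sphere (pt 0 1) scal \<inter> hplane 1"
      using scal_pos by (simp add: z surf_unit hplane_def norm_mult)
  next
    fix x assume x: "x \<in> sphere (pt 0 1) scal \<inter> hplane 1"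
    define w where "w = hproj x"
    have xw: "x = pt w 1" using x hplane_iff[of x 1] by (simp add: w_def)
    then have "norm w = scal" using x by simp
    then have "w / of_real scal \<in> sphere 0 1" using scal_pos by (simp add: norm_divide)
    then obtain z where z: "norm z = 1" "mob z = w / of_real scal" using mob_unit_circle by (metis imageE mem_sphere_0)
    then have "surf z = x" using scal_pos by (simp add: surf_unit xw)
    then show "x \<in> surf ` sphere 0 1" using z by auto
  qed
qed

lemma boundary_in_planes:
  "surf ` (sphere 0 1 \<union> sphere 0 4) \<inter> hplane 1 = surf ` sphere 0 1"
  "surf ` (sphere 0 1 \<union> sphere 0 4) \<inter> hplane (- 1) = surf ` sphere 0 4"
proof -
  have "surf ` sphere 0 1 \<subseteq> hplane 1" "surf ` sphere 0 4 \<subseteq> hplane (- 1)"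
    by (auto simp: hplane_def surf_unit surf_outer)
  moreover have "hplane 1 \<inter> hplane (- 1) = {}" by (auto simp: hplane_def)
  ultimately show "surf ` (sphere 0 1 \<union> sphere 0 4) \<inter> hplane 1 = surf ` sphere 0 1"
    "surf ` (sphere 0 1 \<union> sphere 0 4) \<inter> hplane (- 1) = surf ` sphere 0 4"
    unfolding image_Un by blast+
qed

lemma level_set:
  assumes "1 \<le> \<rho>" "\<rho> \<le> 4" "\<rho> \<noteq> 2"
  shows "surf ` punctured_annulus 1 4 2 \<inter> hplane (1 - ln \<rho> / ln 2) = surf ` sphere (0::complex) \<rho>"
proof (intro equalityI subsetI)
  fix x assume "x \<in> surf ` punctured_annulus 1 4 2 \<inter> hplane (1 - ln \<rho> / ln 2)"
  then obtain z where z: "1 \<le> norm z" "x = surf z" "ln (norm z) = ln \<rho>"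
    using ln_numerals(2) unfolding punctured_annulus_def hplane_def
    by (fastforce simp: surf_def)
  have "norm z > 0" "\<rho> > 0" using z(1) assms by linarith+
  then have "norm z = \<rho>" using z(3) by (metis exp_ln)
  then show "x \<in> surf ` sphere (0::complex) \<rho>" using z by auto
next
  fix x assume "x \<in> surf ` sphere (0::complex) \<rho>"
  then show "x \<in> surf ` punctured_annulus 1 4 2 \<inter> hplane (1 - ln \<rho> / ln 2)"
    using assms by (auto simp: punctured_annulus_def hplane_def surf_def)
qed

lemma continuous_on_surf: "continuous_on (collar - {2}) surf"
proof (rule continuous_at_imp_continuous_on, rule ballI)
  fix z assume "z \<in> collar - {2}"
  then have "\<exists>D. (surf has_derivative D) (at z)"
    using surf_data unfolding weierstrass_data_def by blast
  then show "isCont surf z" using has_derivative_continuous by blast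
qed

lemma continuous_on_hor: "continuous_on (collar - {2}) hor"
proof (rule continuous_at_imp_continuous_on, rule ballI)
  fix z assume "z \<in> collar - {2}"
  then show "isCont hor z" using has_derivative_continuous[OF has_derivative_hor[of z]] by simp
qed

lemma level_curve:
  assumes "1 \<le> \<rho>" "\<rho> \<le> 4" "\<rho> \<noteq> 2"
  shows "jordan_curve_in (1 - ln \<rho> / ln 2) (surf ` sphere (0::complex) \<rho>)"
    "simple_path ((\<lambda>z. of_real scal * hor z) \<circ> circlepath 0 \<rho>)"
    "pathfinish ((\<lambda>z. of_real scal * hor z) \<circ> circlepath 0 \<rho>) = pathstart ((\<lambda>z. of_real scal * hor z) \<circ> circlepath 0 \<rho>)"
    "path_image ((\<lambda>z. of_real scal * hor z) \<circ> circlepath 0 \<rho>) = hproj ` surf ` sphere (0::complex) \<rho>"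
proof -
  have sub: "sphere (0::complex) \<rho> \<subseteq> {z. 1 \<le> norm z \<and> norm z \<le> 4} - {2}" "sphere (0::complex) \<rho> \<subseteq> collar - {2}"
    using assms by (auto simp: collar_def)
  have im: "path_image (circlepath 0 \<rho>) = sphere (0::complex) \<rho>" using assms by simp
  have s: "simple_path (circlepath 0 \<rho>)" using assms by (simp add: simple_path_circlepath)
  have "simple_path (surf \<circ> circlepath 0 \<rho>)"
    by (rule simple_path_continuous_image[OF s])
      (simp_all only: im continuous_on_subset[OF continuous_on_surf sub(2)] inj_on_subset[OF inj_on_surf sub(1)])
  moreover have "surf ` sphere (0::complex) \<rho> \<subseteq> hplane (1 - ln \<rho> / ln 2)"
    by (auto simp: hplane_def surf_def)
  ultimately show "jordan_curve_in (1 - ln \<rho> / ln 2) (surf ` sphere (0::complex) \<rho>)"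
    unfolding jordan_curve_in_def
    by (auto intro!: exI[of _ "surf \<circ> circlepath 0 \<rho>"] simp: path_image_compose im pathfinish_compose pathstart_compose
       simp del: path_image_circlepath)
  have "inj_on (\<lambda>z. of_real scal * hor z) (sphere (0::complex) \<rho>)"
    using inj_on_subset[OF inj_on_hor sub(1)] scal_pos by (auto simp: inj_on_def)
  moreover have "continuous_on (sphere (0::complex) \<rho>) (\<lambda>z. of_real scal * hor z)"
    by (intro continuous_intros continuous_on_subset[OF continuous_on_hor sub(2)])
  ultimately show "simple_path ((\<lambda>z. of_real scal * hor z) \<circ> circlepath 0 \<rho>)"
    by (intro simple_path_continuous_image[OF s]) (simp_all only: im)
  show "pathfinish ((\<lambda>z. of_real scal * hor z) \<circ> circlepath 0 \<rho>) = pathstart ((\<lambda>z. of_real scal * hor z) \<circ> circlepath 0 \<rho>)"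
    by (simp add: pathfinish_compose pathstart_compose)
  show "path_image ((\<lambda>z. of_real scal * hor z) \<circ> circlepath 0 \<rho>) = hproj ` surf ` sphere (0::complex) \<rho>"
    by (simp only: path_image_compose im image_image) (simp add: surf_def)
qed

section \<open>The outer boundary is not a circle\<close>

text \<open>On the circle through \<open>z\<close> one has \<open>1 / z = cnj z / (norm z)\<^sup>2\<close>, which turns \<open>corr1 (Ln z)\<close> into
  \<open>((1 - 1 / (norm z)\<^sup>2) * (4 z + cnj z) - 8 ln (norm z)) / 3\<close>.\<close>

lemma hor_first_order:
  assumes "z \<in> collar"
  shows "\<bar>Re (hor z) - (Re (mob z) + eps * ((5 * (1 - 1 / (norm z)\<^sup>2) * Re z - 8 * ln (norm z)) / 3))\<bar> \<le> eps / 1000"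
    "\<bar>Im (hor z) - (Im (mob z) + eps * ((1 - 1 / (norm z)\<^sup>2) * Im z))\<bar> \<le> eps / 1000"
proof -
  define d where "d = hor z - (mob z + of_real eps * corr1 (Ln z))"
  have z: "z \<noteq> 0" using collar_nonzero[OF assms] .
  have d: "norm d \<le> eps / 1000"
    using corr_first_order[OF Ln_strip[OF assms]] by (simp add: d_def hor_def)
  define k where "k = 1 / (norm z)\<^sup>2"
  have i: "1 / z = of_real k * cnj z"
    using z complex_norm_square[of z] by (simp add: k_def field_simps power2_eq_square)
  have i': "1 / cnj z = of_real k * z"
    using arg_cong[OF i, of cnj] by simp
  have "exp (- cnj (Ln z)) = 1 / cnj z" "exp (cnj (Ln z)) = cnj z" "exp (- Ln z) = 1 / z"
    using z by (simp_all add: exp_minus inverse_eq_divide flip: exp_cnj)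
  then have c: "corr1 (Ln z) = (4 * (z - of_real k * z)
      + (cnj z - of_real k * cnj z) - 8 * of_real (ln (norm z))) / 3"
    using z by (simp add: corr1_def i i')
  have R: "Re (corr1 (Ln z)) = (5 * (1 - 1 / (norm z)\<^sup>2) * Re z - 8 * ln (norm z)) / 3"
    unfolding c k_def[symmetric] by (simp add: field_simps)
  have I: "Im (corr1 (Ln z)) = (1 - 1 / (norm z)\<^sup>2) * Im z"
    unfolding c k_def[symmetric] by (simp add: field_simps)
  show "\<bar>Re (hor z) - (Re (mob z) + eps * ((5 * (1 - 1 / (norm z)\<^sup>2) * Re z - 8 * ln (norm z)) / 3))\<bar> \<le> eps / 1000"
    unfolding R[symmetric] using order_trans[OF abs_Re_le_cmod d] by (simp add: d_def)
  show "\<bar>Im (hor z) - (Im (mob z) + eps * ((1 - 1 / (norm z)\<^sup>2) * Im z))\<bar> \<le> eps / 1000"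
    unfolding I[symmetric] using order_trans[OF abs_Im_le_cmod d] by (simp add: d_def)
qed

lemma hor_cnj: assumes "z \<in> collar" shows "hor (cnj z) = cnj (hor z)"
proof -
  have s: "cnj (Ln z) \<in> strip" using Ln_strip[OF assms] by (simp add: strip_reflect)
  have "hor (cnj z) = hor (exp (cnj (Ln z)))"
    using collar_nonzero[OF assms] by (simp flip: exp_cnj)
  also have "\<dots> = mob (cnj z) + cnj (corr (Ln z))"
    using hor_exp[OF s] corr_cnj[OF Ln_strip[OF assms]] collar_nonzero[OF assms] by (simp flip: exp_cnj)
  also have "\<dots> = cnj (hor z)" by (simp add: hor_def mob_def)
  finally show ?thesis .
qed

text \<open>By the symmetry under conjugation, the centre of such a circle would be real, hence the midpoint of
  the real points \<open>a1\<close> and \<open>b1\<close> over \<open>4\<close> and \<open>- 4\<close>. A point \<open>(x1, y1)\<close> lies on the circle with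
  diameter from \<open>b1\<close> to \<open>a1\<close> iff \<open>(x1 - a1) * (x1 - b1) + y1\<^sup>2 = 0\<close>. For the point over \<open>4 * \<i>\<close> the left
  side vanishes at \<open>eps = 0\<close>, but its derivative with respect to \<open>eps\<close> is \<open>17\<close>.\<close>

lemma outer_boundary_not_circle: "\<not> circle_in (- 1) (surf ` sphere 0 4)"
proof
  assume "circle_in (- 1) (surf ` sphere 0 4)"
  then obtain c \<rho> where c: "c \<in> hplane (- 1)" and C: "surf ` sphere 0 4 = sphere c \<rho> \<inter> hplane (- 1)"
    unfolding circle_in_def by blast
  define m where "m = hproj c / of_real scal"
  have cm: "c = pt (of_real scal * m) (- 1)"
    using c scal_pos hplane_iff[of c "- 1"] by (simp add: m_def)
  have dist: "(Re (hor z) - Re m)\<^sup>2 + (Im (hor z) - Im m)\<^sup>2 = (\<rho> / scal)\<^sup>2" if "norm z = 4" for z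
  proof -
    have "surf z \<in> sphere c \<rho>" using C that by auto
    then have "norm (of_real scal * (m - hor z)) = \<rho>"
      by (simp add: cm surf_outer[OF that] dist_norm pt_diff right_diff_distrib)
    then have "norm (hor z - m) * scal = \<rho>"
      using scal_pos by (simp only: norm_mult norm_minus_commute mult.commute norm_of_real abs_of_pos)
    then have "norm (hor z - m) = \<rho> / scal"
      using scal_pos by (simp add: eq_divide_eq)
    then show ?thesis using cmod_power2[of "hor z - m"] by simp
  qed
  have col: "4 \<in> collar" "- 4 \<in> collar" "4 * \<i> \<in> collar" by (auto simp: collar_def norm_mult)
  define K where "K = 8 / 3 * ln (4::real)"
  have real: "Im (hor 4) = 0" "Im (hor (- 4)) = 0"
    using hor_cnj[OF col(1)] hor_cnj[OF col(2)] by (simp_all add: complex_eq_iff)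
  have sym: "hor (- (4 * \<i>)) = cnj (hor (4 * \<i>))" using hor_cnj[OF col(3)] by simp
  have a: "\<bar>Re (hor 4) - (- 7 / 2 + eps * (25 / 4 - K))\<bar> \<le> eps / 1000"
    using hor_first_order(1)[OF col(1)] by (simp add: mob_def K_def field_simps)
  have b: "\<bar>Re (hor (- 4)) - (- 3 / 2 + eps * (- 25 / 4 - K))\<bar> \<le> eps / 1000"
    using hor_first_order(1)[OF col(2)] by (simp add: mob_def K_def field_simps)
  have mi: "mob (4 * \<i>) = Complex (- 17 / 10) (3 / 5)"
    by (simp add: mob_def complex_eq_iff Re_divide Im_divide power2_eq_square)
  have x: "\<bar>Re (hor (4 * \<i>)) - (- 17 / 10 + eps * (- K))\<bar> \<le> eps / 1000"
    using hor_first_order(1)[OF col(3)] unfolding mi K_def by (simp add: norm_mult field_simps)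
  have y: "\<bar>Im (hor (4 * \<i>)) - (3 / 5 + eps * (15 / 4))\<bar> \<le> eps / 1000"
    using hor_first_order(2)[OF col(3)] unfolding mi by (simp add: norm_mult field_simps)
  define x1 y1 a1 b1 where xy: "x1 = Re (hor (4 * \<i>))" "y1 = Im (hor (4 * \<i>))" "a1 = Re (hor 4)" "b1 = Re (hor (- 4))"
  have d1: "(x1 - Re m)\<^sup>2 + (y1 - Im m)\<^sup>2 = (\<rho> / scal)\<^sup>2"
    using dist[of "4 * \<i>"] by (simp add: xy norm_mult)
  have d2: "(x1 - Re m)\<^sup>2 + (- y1 - Im m)\<^sup>2 = (\<rho> / scal)\<^sup>2"
    using dist[of "- (4 * \<i>)"] by (simp add: sym xy norm_mult)
  have d3: "(a1 - Re m)\<^sup>2 + (Im m)\<^sup>2 = (\<rho> / scal)\<^sup>2" "(b1 - Re m)\<^sup>2 + (Im m)\<^sup>2 = (\<rho> / scal)\<^sup>2"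
    using dist[of 4] dist[of "- 4"] real by (simp_all add: xy)
  have e: "0 < eps" "eps \<le> 1 / 1000" by (simp_all add: eps_def)
  (* Deviations from the values at eps = 0. *)
  define p q r where pqr: "p = x1 - a1 - 9 / 5" "q = x1 - b1 + 1 / 5" "r = y1 - 3 / 5"
  have p: "- 7 * eps \<le> p" "p \<le> - 6 * eps" and q: "6 * eps \<le> q" "q \<le> 7 * eps" and r: "3 * eps \<le> r"
    using a b x y e unfolding pqr xy ring_distribs by linarith+
  have "(y1 - Im m)\<^sup>2 = (- y1 - Im m)\<^sup>2" using d1 d2 by linarith
  then have "y1 * Im m = 0" by (simp add: power2_eq_square algebra_simps)
  then have Im: "Im m = 0" using r e by (auto simp: pqr)
  have "(a1 - Re m)\<^sup>2 = (b1 - Re m)\<^sup>2" using d3 by linarith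
  then have "(a1 - b1) * (a1 + b1 - 2 * Re m) = 0"
    by (simp add: power2_eq_square algebra_simps)
  moreover have "a1 - b1 \<noteq> 0" using p q e by (auto simp: pqr)
  ultimately have "a1 + b1 - 2 * Re m = 0" by simp
  then have M: "Re m = (a1 + b1) / 2" by simp
  have "(x1 - Re m)\<^sup>2 + y1\<^sup>2 = (a1 - Re m)\<^sup>2" using d1 d3 Im by simp
  then have "(x1 - a1) * (x1 - b1) + y1\<^sup>2 = 0"
    unfolding M by (simp add: power2_eq_square field_simps)
  moreover have "x1 - a1 = 9 / 5 + p" "x1 - b1 = q - 1 / 5" "y1 = 3 / 5 + r" by (simp_all add: pqr)
  ultimately have "(9 / 5 + p) * (q - 1 / 5) + (3 / 5 + r)\<^sup>2 = 0" by simp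
  then have eq: "9 / 5 * q + p * q - p / 5 + 6 / 5 * r + r\<^sup>2 = 0"
    by (simp add: power2_eq_square field_simps)
  have "- (p * q) \<le> (7 * eps) * (7 * eps)"
    using p q e mult_mono[of "- p" "7 * eps" q "7 * eps"] by simp
  moreover have "eps * eps \<le> eps * (1 / 1000)" using e by (intro mult_left_mono) auto
  ultimately have "- (p * q) \<le> eps" using e by linarith
  then show False using eq p q r e zero_le_power2[of r] by linarith
qed

section \<open>A non-convex level curve\<close>

text \<open>On the circle \<open>norm z = 2\<close> the map \<open>mob\<close> takes values on the line \<open>Re = - 5 / 4\<close>, and to first order
  the correction displaces the point over \<open>2 * exp (\<i> * \<theta>)\<close> horizontally by
  \<open>eps * (5 / 2 * cos \<theta> - 8 / 3 * ln 2)\<close>. Over \<open>- 2\<close>, \<open>2 * \<i>\<close> and \<open>2 * (4 + 3 * \<i>) / 5\<close> the heights in the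
  plane are about \<open>0\<close>, \<open>3 / 4\<close>, \<open>9 / 4\<close>, with displacements proportional to \<open>- 5 / 2\<close>, \<open>0\<close>, \<open>2\<close>: the
  middle point \<open>Q\<close> lies to the right of the chord joining the outer points \<open>A\<close> and \<open>B\<close>. For \<open>\<rho> < 2\<close> near \<open>2\<close>
  the positions hardly change, and the level curve has a fourth point \<open>C\<close>, over \<open>\<rho>\<close>, that lies far to the right.
  So \<open>Q\<close> is in the open triangle \<open>A\<close>, \<open>B\<close>, \<open>C\<close>.\<close>

lemma nonconvex_level:
  "\<exists>\<rho>. 1 < \<rho> \<and> \<rho> < 2 \<and> \<not> convex_curve (surf ` sphere (0::complex) \<rho>)"
proof -
  define K where "K = 8 / 3 * ln (2::real)"
  define u v where uv: "u = (\<i>::complex)" "v = Complex (4/5) (3/5)"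
  have nv: "norm v = 1" "norm u = 1" by (simp_all add: uv cmod_def power2_eq_square)
  have col: "2 * w \<in> collar" "2 * w \<noteq> 2" if "w \<in> {- 1, u, v}" for w
  proof -
    have "norm w = 1" using that nv by auto
    then show "2 * w \<in> collar" by (simp add: collar_def norm_mult)
    show "2 * w \<noteq> 2" using that by (auto simp: uv complex_eq_iff)
  qed
  have close: "eventually (\<lambda>\<rho>. norm (hor (of_real \<rho> * w) - hor (2 * w)) < eps / 1000) (at_left 2)"
    if w: "w \<in> {- 1, u, v}" for w
  proof -
    have "isCont hor (2 * w)"
      using has_derivative_continuous[OF has_derivative_hor[OF col[OF w]]] .
    then have "isCont (\<lambda>\<rho>. hor (of_real \<rho> * w)) (2::real)"
      using isCont_o2[where g = hor and f = "\<lambda>\<rho>::real. of_real \<rho> * w" and a = 2] by simp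
    then have "((\<lambda>\<rho>. hor (of_real \<rho> * w)) \<longlongrightarrow> hor (2 * w)) (at_left 2)"
      by (auto simp: isCont_def filterlim_at_split)
    from tendstoD[OF this, of "eps / 1000"] show ?thesis
      using eps_pos by (simp add: dist_norm)
  qed
  have "eventually (\<lambda>\<rho>::real. 1.999 < \<rho> \<and> \<rho> < 2) (at_left 2)"
    by (auto simp: eventually_at_left[of "1::real"] intro!: exI[of _ "1.999"])
  from eventually_conj[OF this eventually_conj[OF close[of "- 1"] eventually_conj[OF close[of u] close[of v]]]]
  obtain \<rho> where \<rho>: "1.999 < \<rho>" "\<rho> < 2"
    and c: "norm (hor (of_real \<rho> * (- 1)) - hor (2 * (- 1))) < eps / 1000"
      "norm (hor (of_real \<rho> * u) - hor (2 * u)) < eps / 1000"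
      "norm (hor (of_real \<rho> * v) - hor (2 * v)) < eps / 1000"
    by (auto dest!: eventually_happens)
  define A where "A = hor (of_real \<rho> * (- 1))"
  define B where "B = hor (of_real \<rho> * v)"
  define C where "C = hor (of_real \<rho>)"
  define Q where "Q = hor (of_real \<rho> * u)"
  have e: "0 < eps" "eps \<le> 1 / 10000000" by (simp_all add: eps_def)
  have m: "mob (2 * (- 1)) = Complex (- 5 / 4) 0" "mob (2 * u) = Complex (- 5 / 4) (3 / 4)"
      "mob (2 * v) = Complex (- 5 / 4) (9 / 4)"
    by (simp_all add: mob_def uv complex_eq_iff Re_divide Im_divide power2_eq_square)
  note fo = hor_first_order(1)[OF col(1)] hor_first_order(2)[OF col(1)]
  have A: "\<bar>Re A - (- 5 / 4 + eps * (- 5 / 2 - K))\<bar> \<le> eps / 500" "\<bar>Im A\<bar> \<le> eps / 500"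
  proof -
    have "\<bar>Re (hor (2 * (- 1))) - (- 5 / 4 + eps * (- 5 / 2 - K))\<bar> \<le> eps / 1000"
      using fo(1)[of "- 1"] unfolding m by (simp add: K_def norm_mult nv diff_divide_distrib)
    moreover have "\<bar>Im (hor (2 * (- 1)))\<bar> \<le> eps / 1000"
      using fo(2)[of "- 1"] unfolding m by (simp add: norm_mult nv)
    moreover have "\<bar>Re A - Re (hor (2 * (- 1)))\<bar> \<le> eps / 1000" "\<bar>Im A - Im (hor (2 * (- 1)))\<bar> \<le> eps / 1000"
      using c(1)[folded A_def] abs_Re_le_cmod[of "A - hor (2 * (- 1))"] abs_Im_le_cmod[of "A - hor (2 * (- 1))"]
      unfolding minus_complex.sel by linarith+
    ultimately show "\<bar>Re A - (- 5 / 4 + eps * (- 5 / 2 - K))\<bar> \<le> eps / 500" "\<bar>Im A\<bar> \<le> eps / 500"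
      by linarith+
  qed
  have Q: "\<bar>Re Q - (- 5 / 4 + eps * (- K))\<bar> \<le> eps / 500" "\<bar>Im Q - (3 / 4 + eps * (3 / 2))\<bar> \<le> eps / 500"
  proof -
    have "\<bar>Re (hor (2 * u)) - (- 5 / 4 + eps * (- K))\<bar> \<le> eps / 1000"
      using fo(1)[of "u"] unfolding m by (simp add: K_def norm_mult nv diff_divide_distrib, simp add: uv)
    moreover have "\<bar>Im (hor (2 * u)) - (3 / 4 + eps * (3 / 2))\<bar> \<le> eps / 1000"
      using fo(2)[of "u"] unfolding m by (simp add: norm_mult nv, simp add: uv)
    moreover have "\<bar>Re Q - Re (hor (2 * u))\<bar> \<le> eps / 1000" "\<bar>Im Q - Im (hor (2 * u))\<bar> \<le> eps / 1000"
      using c(2)[folded Q_def] abs_Re_le_cmod[of "Q - hor (2 * u)"] abs_Im_le_cmod[of "Q - hor (2 * u)"]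
      unfolding minus_complex.sel by linarith+
    ultimately show "\<bar>Re Q - (- 5 / 4 + eps * (- K))\<bar> \<le> eps / 500" "\<bar>Im Q - (3 / 4 + eps * (3 / 2))\<bar> \<le> eps / 500"
      by linarith+
  qed
  have B: "\<bar>Re B - (- 5 / 4 + eps * (2 - K))\<bar> \<le> eps / 500" "\<bar>Im B - (9 / 4 + eps * (9 / 10))\<bar> \<le> eps / 500"
  proof -
    have "\<bar>Re (hor (2 * v)) - (- 5 / 4 + eps * (2 - K))\<bar> \<le> eps / 1000"
      using fo(1)[of "v"] unfolding m by (simp add: K_def norm_mult nv diff_divide_distrib, simp add: uv)
    moreover have "\<bar>Im (hor (2 * v)) - (9 / 4 + eps * (9 / 10))\<bar> \<le> eps / 1000"
      using fo(2)[of "v"] unfolding m by (simp add: norm_mult nv, simp add: uv)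
    moreover have "\<bar>Re B - Re (hor (2 * v))\<bar> \<le> eps / 1000" "\<bar>Im B - Im (hor (2 * v))\<bar> \<le> eps / 1000"
      using c(3)[folded B_def] abs_Re_le_cmod[of "B - hor (2 * v)"] abs_Im_le_cmod[of "B - hor (2 * v)"]
      unfolding minus_complex.sel by linarith+
    ultimately show "\<bar>Re B - (- 5 / 4 + eps * (2 - K))\<bar> \<le> eps / 500" "\<bar>Im B - (9 / 4 + eps * (9 / 10))\<bar> \<le> eps / 500"
      by linarith+
  qed
  have mC: "mob (of_real \<rho>) = of_real (- 2 + 3 / (2 - \<rho>))"
  proof -
    have "- 2 + 3 / (2 - \<rho>) = (1 - 2 * \<rho>) / (\<rho> - 2)" using \<rho> by (simp add: field_simps)
    then show ?thesis by (simp add: mob_def)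
  qed
  have "norm (C - mob (of_real \<rho>)) \<le> 1680 * eps"
    unfolding C_def using \<rho> by (intro norm_hor_minus_mob) (simp add: collar_def)
  then have dC: "norm (C - mob (of_real \<rho>)) \<le> 1 / 100" using e by linarith
  (* The pole of mob at 2 moves C far away. *)
  have "3 / (2 - \<rho>) \<ge> 3000" using \<rho> by (simp add: field_simps)
  then have C: "Re C \<ge> 2000" "\<bar>Im C\<bar> \<le> 1 / 100"
    using dC abs_Re_le_cmod[of "C - mob (of_real \<rho>)"] abs_Im_le_cmod[of "C - mob (of_real \<rho>)"]
    unfolding mC by simp_all
  have "0 < K" "K < 3" using ln_numerals(2,3) by (simp_all add: K_def)
  then have K: "0 < eps * K" "eps * K < 3 * eps" using e by simp_all
  note bounds = A[unfolded abs_le_iff ring_distribs] B[unfolded abs_le_iff ring_distribs]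
    C[unfolded abs_le_iff] Q[unfolded abs_le_iff ring_distribs] e K
  have o1: "orient A B Q < 0"
  proof -
    have "(Re B - Re A) * (Im Q - Im A) \<le> (46 / 10 * eps) * (8 / 10)"
      using bounds by (intro mult_mono) linarith+
    moreover have "(22 / 10) * (24 / 10 * eps) \<le> (Im B - Im A) * (Re Q - Re A)"
      using bounds by (intro mult_mono) linarith+
    ultimately show ?thesis unfolding orient_coordinates using e by linarith
  qed
  have o2: "orient B C Q < 0"
  proof -
    have "2000 * 1 \<le> (Re C - Re B) * (Im B - Im Q)"
      using bounds by (intro mult_mono) linarith+
    moreover have "(Im B - Im C) * (Re B - Re Q) \<ge> 0"
      using bounds by (intro mult_nonneg_nonneg) linarith+
    moreover have "orient B C Q = - ((Re C - Re B) * (Im B - Im Q)) - (Im B - Im C) * (Re B - Re Q)"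
      unfolding orient_coordinates by (simp add: algebra_simps)
    ultimately show ?thesis by linarith
  qed
  have o3: "orient C A Q < 0"
  proof -
    define d where "d = Re C - Re A"
    have d: "0 < d" using bounds by (simp only: d_def) linarith
    have "d * (7 / 10) \<le> d * (Im Q - Im C)"
      using d bounds by (intro mult_left_mono) linarith+
    moreover have "(Im A - Im C) * (Re C - Re Q) \<le> (1 / 10) * d"
      unfolding d_def using bounds by (intro mult_mono) linarith+
    moreover have "orient C A Q = - (d * (Im Q - Im C)) + (Im A - Im C) * (Re C - Re Q)"
      unfolding orient_coordinates d_def by (simp add: algebra_simps)
    ultimately show ?thesis using d by argo
  qed
  have lv: "1 \<le> \<rho>" "\<rho> \<le> 4" "\<rho> \<noteq> 2" using \<rho> by auto
  note cur = level_curve(2-4)[OF lv]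
  have mem: "of_real scal * hor (of_real \<rho> * w) \<in> hproj ` surf ` sphere (0::complex) \<rho>" if "norm w = 1" for w
    using that \<rho> by (auto simp: image_image surf_def norm_mult intro!: image_eqI[of _ _ "of_real \<rho> * w"])
  have sq: "scal\<^sup>2 > 0" using scal_pos by simp
  have "\<not> convex (inside (hproj ` surf ` sphere (0::complex) \<rho>))"
    unfolding cur(3)[symmetric]
  proof (rule nonconvex_inside_if_point_in_triangle[OF cur(1,2)])
    show "of_real scal * A \<in> path_image ((\<lambda>z. of_real scal * hor z) \<circ> circlepath 0 \<rho>)"
      "of_real scal * B \<in> path_image ((\<lambda>z. of_real scal * hor z) \<circ> circlepath 0 \<rho>)"
      "of_real scal * C \<in> path_image ((\<lambda>z. of_real scal * hor z) \<circ> circlepath 0 \<rho>)"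
      "of_real scal * Q \<in> path_image ((\<lambda>z. of_real scal * hor z) \<circ> circlepath 0 \<rho>)"
      unfolding cur(3) using mem[of "- 1"] mem[of 1] mem[of u] mem[of v] nv
      by (simp_all add: A_def B_def C_def Q_def)
  qed (use o1 o2 o3 sq in \<open>simp_all only: scaled_orient mult_pos_neg\<close>)
  then show ?thesis
    using \<rho> by (intro exI[of _ \<rho>]) (auto simp: convex_curve_def enclosed_def)
qed

section \<open>Strict convexity of the outer boundary\<close>

lemma second_order_Taylor:
  fixes f :: "complex \<Rightarrow> complex"
  assumes "convex S" and "\<And>x. x \<in> S \<Longrightarrow> (f has_field_derivative f' x) (at x)"
    and "\<And>x. x \<in> S \<Longrightarrow> (f' has_field_derivative f'' x) (at x)"
    and "\<And>x. x \<in> S \<Longrightarrow> norm (f'' x) \<le> B" and "s \<in> S" "t \<in> S"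
  shows "norm (f s - f t - f' t * (s - t)) \<le> B * (norm (s - t))\<^sup>2"
proof -
  define F where "F i = (if i = 0 then f else if i = 1 then f' else f'')" for i :: nat
  have "norm (F 0 s - (\<Sum>i\<le>1. F i t * (s - t) ^ i / fact i)) \<le> B * norm (s - t) ^ Suc 1 / fact 1"
  proof (rule complex_Taylor[OF assms(1) _ _ assms(6,5)])
    show "(F i has_field_derivative F (Suc i) x) (at x within S)" if "x \<in> S" "i \<le> 1" for i x
      using that assms(2,3) by (cases "i = 0") (auto simp: F_def intro: has_field_derivative_at_within)
    show "norm (F (Suc 1) x) \<le> B" if "x \<in> S" for x using assms(4) that by (simp add: F_def)
  qed
  then show ?thesis by (simp add: F_def power2_eq_square algebra_simps)
qed

text \<open>Cauchy's estimate on disks of radius \<open>1 / 10\<close>, which fit into the strip because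
  \<open>ln 4 + 1 / 10 < ln 5\<close>.\<close>

lemma norm_deriv_dens_exp_le:
  assumes "\<bar>Re s\<bar> \<le> ln 4"
  shows "norm (deriv (\<lambda>s. dens (exp s)) s) \<le> 4200 * eps"
proof -
  have "ln 5 = ln 4 + ln (1 + 1 / 4 :: real)" by (simp flip: ln_mult_pos)
  moreover have "1 / 4 - (1 / 4)\<^sup>2 \<le> ln (1 + 1 / 4 :: real)"
    by (rule ln_one_plus_pos_lower_bound) auto
  ultimately have gap: "ln 4 + 1 / 10 < ln (5::real)" by (simp add: power2_eq_square)
  have sub: "cball s (1 / 10) \<subseteq> strip"
  proof
    fix x assume "x \<in> cball s (1 / 10)"
    then have "\<bar>Re (s - x)\<bar> \<le> 1 / 10" using abs_Re_le_cmod[of "s - x"] by (simp add: dist_norm)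
    then show "x \<in> strip" using assms gap unfolding strip_def mem_Collect_eq minus_complex.sel by linarith
  qed
  have "norm ((deriv ^^ 1) (\<lambda>s. dens (exp s)) s) \<le> fact 1 * (420 * eps) / (1 / 10) ^ 1"
  proof (rule Cauchy_inequality)
    show "(\<lambda>s. dens (exp s)) holomorphic_on ball s (1 / 10)"
      using sub ball_subset_cball by (blast intro: holomorphic_on_subset[OF holomorphic_on_dens_exp])
    show "continuous_on (cball s (1 / 10)) (\<lambda>s. dens (exp s))"
      using sub by (intro holomorphic_on_imp_continuous_on holomorphic_on_subset[OF holomorphic_on_dens_exp])
    show "norm (dens (exp x)) \<le> 420 * eps" if "norm (s - x) = 1 / 10" for x
    proof -
      have "x \<in> strip" using that sub by (auto simp: dist_norm)
      then show ?thesis using exp_strip_iff norm_dens_le by blast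
    qed
  qed auto
  then show ?thesis by simp
qed

lemma prim_Taylor:
  assumes "\<bar>Re s\<bar> \<le> ln 4" "\<bar>Re t\<bar> \<le> ln 4"
  shows "norm (prim s - prim t - dens (exp t) * (s - t)) \<le> 4200 * eps * (norm (s - t))\<^sup>2"
proof (rule second_order_Taylor[where S = "{s. \<bar>Re s\<bar> \<le> ln 4}"])
  have eq: "{s. \<bar>Re s\<bar> \<le> ln 4} = {s. Re s \<le> ln 4} \<inter> {s. Re s \<ge> - ln 4}" by auto
  show "convex {s. \<bar>Re s\<bar> \<le> ln 4}"
    unfolding eq by (intro convex_Int convex_halfspace_Re_le convex_halfspace_Re_ge)
  have str: "x \<in> strip" if "x \<in> {s. \<bar>Re s\<bar> \<le> ln 4}" for x
    using that ln_numerals(4) unfolding strip_def mem_Collect_eq by linarith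
  show "(prim has_field_derivative dens (exp x)) (at x)" if "x \<in> {s. \<bar>Re s\<bar> \<le> ln 4}" for x
    using has_field_derivative_prim[OF str[OF that]] .
  show "((\<lambda>s. dens (exp s)) has_field_derivative deriv (\<lambda>s. dens (exp s)) x) (at x)"
    if "x \<in> {s. \<bar>Re s\<bar> \<le> ln 4}" for x
    using holomorphic_derivI[OF holomorphic_on_dens_exp open_strip str[OF that]] .
qed (use assms norm_deriv_dens_exp_le in auto)

lemma mob_exp_Taylor:
  assumes "Re s = ln 4" "Re t = ln 4"
  shows "norm (mob (exp s) - mob (exp t) - 3 * exp t / (exp t - 2)\<^sup>2 * (s - t)) \<le> 9 * (norm (s - t))\<^sup>2"
proof (rule second_order_Taylor[where S = "{s. Re s = ln 4}"])
  have eq: "{s. Re s = ln 4} = {s. Re s \<le> ln 4} \<inter> {s. Re s \<ge> ln 4}" by auto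
  show "convex {s. Re s = ln 4}"
    unfolding eq by (intro convex_Int convex_halfspace_Re_le convex_halfspace_Re_ge)
  fix x assume "x \<in> {s. Re s = ln 4}"
  then have n: "norm (exp x) = 4" by simp
  have n2: "norm (exp x - 2) \<ge> 2" using norm_triangle_ineq2[of "exp x" 2] n by simp
  then have ne: "exp x - 2 \<noteq> 0" by auto
  show "((\<lambda>s. mob (exp s)) has_field_derivative 3 * exp x / (exp x - 2)\<^sup>2) (at x)"
    unfolding mob_def using ne
    by (auto intro!: derivative_eq_intros simp: power2_eq_square) (simp add: field_simps)
  show "((\<lambda>s. 3 * exp s / (exp s - 2)\<^sup>2) has_field_derivative - 3 * exp x * (exp x + 2) / (exp x - 2) ^ 3) (at x)"
  proof -
    define y where "y = exp x - 2"
    have y: "y \<noteq> 0" "exp x = y + 2" using ne by (auto simp: y_def)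
    have "((\<lambda>s. 3 * exp s / (exp s - 2)\<^sup>2) has_field_derivative
        ((3 * exp x) * (exp x - 2)\<^sup>2 - 3 * exp x * (2 * (exp x - 2) * exp x)) / ((exp x - 2)\<^sup>2 * (exp x - 2)\<^sup>2)) (at x)"
      using ne by (auto intro!: derivative_eq_intros)
    also have "((3 * exp x) * (exp x - 2)\<^sup>2 - 3 * exp x * (2 * (exp x - 2) * exp x)) / ((exp x - 2)\<^sup>2 * (exp x - 2)\<^sup>2)
       = - 3 * exp x * (exp x + 2) / (exp x - 2) ^ 3"
      unfolding y_def[symmetric] y(2) using y(1)
      by (simp add: field_simps power2_eq_square power3_eq_cube)
    finally show ?thesis .
  qed
  have "norm (exp x + 2) \<le> 6" using norm_triangle_ineq[of "exp x" 2] n by simp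
  moreover have "2 ^ 3 \<le> norm (exp x - 2) ^ 3" using n2 by (intro power_mono) auto
  ultimately have "3 * 4 * norm (exp x + 2) / norm (exp x - 2) ^ 3 \<le> 3 * 4 * 6 / 2 ^ 3"
    by (intro frac_le) auto
  then have "3 * 4 * norm (exp x + 2) / norm (exp x - 2) ^ 3 \<le> 9" by simp
  then show "norm (- 3 * exp x * (exp x + 2) / (exp x - 2) ^ 3) \<le> 9"
    using n by (simp only: norm_divide norm_mult norm_power norm_minus_cancel norm_numeral)
qed (use assms in auto)

text \<open>The image of \<open>norm z = 4\<close> under \<open>mob\<close> is the unit circle around \<open>- 5 / 2\<close>. It is traversed clockwise,
  with angular speed \<open>\<sigma>\<close> when \<open>z\<close> moves with unit angular speed.\<close>

lemma mob_outer_circle: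
  assumes "norm z = 4"
  defines "u \<equiv> mob z + 5 / 2" and "\<sigma> \<equiv> 3 / (5 - Re z)"
  shows "norm u = 1" "1 / 3 \<le> \<sigma>" "\<sigma> \<le> 3" "3 * z / (z - 2)\<^sup>2 = - (of_real \<sigma> * u)"
proof -
  have z2: "z - 2 \<noteq> 0" using assms(1) by auto
  have u: "u = (z - 8) / (2 * (z - 2))" using z2 by (simp add: u_def mob_def field_simps)
  have n: "(Re z)\<^sup>2 + (Im z)\<^sup>2 = 16" using assms(1) by (simp flip: cmod_power2)
  have "(norm (z - 8))\<^sup>2 = (norm (2 * (z - 2)))\<^sup>2"
    unfolding cmod_power2 using n by (simp add: power2_eq_square algebra_simps)
  then have "norm (z - 8) = norm (2 * (z - 2))" by (simp only: power2_eq_iff_nonneg norm_ge_zero)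
  then show "norm u = 1" using z2 by (simp add: u norm_divide norm_mult)
  have r: "\<bar>Re z\<bar> \<le> 4" using abs_Re_le_cmod[of z] assms(1) by simp
  then show "1 / 3 \<le> \<sigma>" "\<sigma> \<le> 3" by (auto simp: \<sigma>_def field_simps)
  have quad: "(z - 8) * (z - 2) = - 2 * (of_real (5 - Re z)) * z"
    using n by (simp add: complex_eq_iff power2_eq_square algebra_simps)
  have "of_real (5 - Re z) * (3 * z * (2 * (z - 2))) = - 3 * (z - 2) * (- 2 * (of_real (5 - Re z)) * z)"
    by (simp add: algebra_simps)
  also have "\<dots> = - (3 * (z - 8) * (z - 2)\<^sup>2)"
    unfolding quad[symmetric] by (simp add: power2_eq_square algebra_simps)
  finally have "of_real (5 - Re z) * (3 * z * (2 * (z - 2))) = - (3 * (z - 8) * (z - 2)\<^sup>2)" .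
  moreover have "of_real (5 - Re z) \<noteq> (0::complex)" using r by (simp only: of_real_eq_0_iff)
  ultimately show "3 * z / (z - 2)\<^sup>2 = - (of_real \<sigma> * u)"
    using z2 unfolding \<sigma>_def u of_real_divide by (simp add: divide_simps mult_ac)
qed

text \<open>The first-order part \<open>(g - of_real \<sigma> * u) * d\<close> of \<open>U + G\<close> drops out: it is orthogonal to
  \<open>of_real \<sigma> * u - g\<close> because \<open>d\<close> is imaginary.\<close>

lemma normal_component_expansion:
  assumes d: "Re d = 0" and U: "U = - (of_real \<sigma> * u) * d + ru" and G: "G = g * d + rg"
  shows "Re (cnj (of_real \<sigma> * u - g) * (U + G)) =
    \<sigma> * Re (cnj u * U) + Re (of_real \<sigma> * cnj u * rg) - Re (cnj g * ru) - Re (cnj g * rg)"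
  unfolding U G using d by (simp add: algebra_simps)

text \<open>The functional is given by the outward normal \<open>of_real \<sigma> * u0 - g0\<close> of the perturbed curve at \<open>z0\<close>.
  With \<open>D = (norm d)\<^sup>2\<close> the square of the parameter distance, the unperturbed circle contributes at
  most \<open>- D / 21600\<close> by its curvature, whereas all contributions of the correction are remainders of
  second-order Taylor expansions and hence bounded by a multiple of \<open>eps * D\<close>.\<close>

lemma outer_support:
  assumes z0: "norm z0 = 4"
  shows "\<exists>n. \<forall>z. norm z = 4 \<and> z \<noteq> z0 \<longrightarrow> n \<bullet> hor z < n \<bullet> hor z0"
proof -
  define u0 where "u0 = mob z0 + 5 / 2"
  define \<sigma> where "\<sigma> = 3 / (5 - Re z0)"
  note m0 = mob_outer_circle[OF z0, folded u0_def \<sigma>_def]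
  define g0 where "g0 = dens z0 - dens (z0 / 16)"
  have "norm g0 \<le> norm (dens z0) + norm (dens (z0 / 16))"
    unfolding g0_def by (rule norm_triangle_ineq4)
  also have "\<dots> \<le> 420 * eps + 420 * eps"
    using z0 by (intro add_mono norm_dens_le) (auto simp: collar_def norm_divide)
  finally have g0: "norm g0 \<le> 840 * eps" by simp
  have "(of_real \<sigma> * u0 - g0) \<bullet> hor z < (of_real \<sigma> * u0 - g0) \<bullet> hor z0" if z: "norm z = 4" "z \<noteq> z0" for z
  proof -
    define s0 where "s0 = Ln z0"
    define d where "d = Ln (z / z0)"
    define s where "s = s0 + d"
    have nz: "z0 \<noteq> 0" "z \<noteq> 0" using z z0 by auto
    have ex: "exp s0 = z0" "exp s = z" using nz by (simp_all add: s0_def s_def d_def exp_add)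
    have Re: "Re s0 = ln 4" "Re d = 0" "Re s = ln 4"
      using nz z z0 by (simp_all add: s0_def s_def d_def norm_divide)
    (* On this circle the reflection of s is a translation, so both primitives are holomorphic in s. *)
    define s0' s' where "s0' = s0 - of_real (2 * ln 4)" "s' = s - of_real (2 * ln 4)"
    have Re': "Re s0' = - ln 4" "Re s' = - ln 4" using Re by (simp_all add: s0'_s'_def)
    have "exp (2 * ln 4) = (16::real)" using exp_add[of "ln 4" "ln (4::real)"] by simp
    then have ex': "exp s0' = z0 / 16"
      by (simp only: s0'_s'_def exp_diff ex exp_of_real) simp
    have str: "s0 \<in> strip" "s \<in> strip"
      using Re ln_numerals(2,4) ln_numerals(1) unfolding strip_def mem_Collect_eq by linarith+
    have refl: "- cnj s0 = s0'" "- cnj s = s'" using Re by (simp_all add: complex_eq_iff s0'_s'_def)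
    have hor: "hor z0 = mob z0 + (prim s0 - prim s0')" "hor z = mob z + (prim s - prim s')"
      using hor_exp[OF str(1)] hor_exp[OF str(2)] by (simp_all add: ex corr_def refl)
    define U where "U = mob z - mob z0"
    define G where "G = (prim s - prim s') - (prim s0 - prim s0')"
    define ru where "ru = U - (- (of_real \<sigma> * u0) * d)"
    define rg where "rg = G - g0 * d"
    define D where "D = (norm d)\<^sup>2"
    have dd: "s - s0 = d" "s' - s0' = d" by (simp_all add: s_def s0'_s'_def)
    have ru: "norm ru \<le> 9 * D"
      using mob_exp_Taylor[OF Re(3,1)] by (simp add: ex dd m0(4) ru_def U_def D_def)
    have "rg = (prim s - prim s0 - dens (exp s0) * (s - s0)) - (prim s' - prim s0' - dens (exp s0') * (s' - s0'))"
      by (simp add: rg_def G_def g0_def dd ex ex' algebra_simps)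
    also have "norm \<dots> \<le> 4200 * eps * (norm (s - s0))\<^sup>2 + 4200 * eps * (norm (s' - s0'))\<^sup>2"
      using Re Re' by (intro order_trans[OF norm_triangle_ineq4] add_mono prim_Taylor) auto
    finally have rg: "norm rg \<le> 8400 * eps * D" by (simp add: dd D_def)
    have u: "norm (u0 + U) = 1"
      using mob_outer_circle(1)[OF z(1)] by (simp add: u0_def U_def add.commute)
    have Re_uU: "Re (cnj u0 * U) = - (norm U)\<^sup>2 / 2"
    proof -
      have "(norm (u0 + U))\<^sup>2 = (norm u0)\<^sup>2 + 2 * Re (cnj u0 * U) + (norm U)\<^sup>2"
        unfolding cmod_power2 by (simp add: power2_eq_square algebra_simps)
      then show ?thesis using u m0(1) by simp
    qed
    have "norm d \<le> 20 * norm (z / z0 - 1)"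
      unfolding d_def using z z0 by (intro norm_Ln_le_norm_minus_one) (simp add: norm_divide)
    also have "z / z0 - 1 = (z - z0) / z0" using nz by (simp add: field_simps)
    also have "norm ((z - z0) / z0) = norm (z - z0) / 4" using z0 by (simp add: norm_divide)
    finally have d1: "norm d \<le> 5 * norm (z - z0)" by simp
    have ne2: "z \<noteq> 2" "z0 \<noteq> 2" using z z0 by auto
    have "norm (z - 2) \<le> 6" "norm (z0 - 2) \<le> 6"
      using z z0 norm_triangle_ineq4[of z 2] norm_triangle_ineq4[of z0 2] by auto
    then have "norm (z - 2) * norm (z0 - 2) \<le> 6 * 6" by (intro mult_mono) auto
    then have "3 * norm (z - z0) / 36 \<le> 3 * norm (z - z0) / (norm (z - 2) * norm (z0 - 2))"
      using ne2 by (intro divide_left_mono) auto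
    also have "\<dots> = norm U"
      by (simp only: U_def mob_diff[OF ne2] norm_divide norm_mult norm_numeral)
    finally have "norm d / 60 \<le> norm U" using d1 by simp
    then have "(norm d / 60)\<^sup>2 \<le> (norm U)\<^sup>2" by (intro power_mono) auto
    then have UD: "D / 3600 \<le> (norm U)\<^sup>2" by (simp add: D_def power_divide)
    have "exp d \<noteq> 1" using z(2) nz by (simp add: d_def)
    then have "d \<noteq> 0" by auto
    then have D: "D > 0" by (simp add: D_def)
    have "1 / 3 * (D / 3600 / 2) \<le> \<sigma> * ((norm U)\<^sup>2 / 2)"
      using UD m0(2) D by (intro mult_mono) auto
    then have t1: "\<sigma> * Re (cnj u0 * U) \<le> - D / 21600" unfolding Re_uU by simp
    have t2: "Re (of_real \<sigma> * cnj u0 * rg) \<le> 25200 * eps * D"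
    proof -
      have "Re (of_real \<sigma> * cnj u0 * rg) \<le> norm (of_real \<sigma> * cnj u0 * rg)" by (rule complex_Re_le_cmod)
      also have "\<dots> = \<sigma> * norm rg" using m0(1,2) by (simp add: norm_mult)
      also have "\<dots> \<le> 3 * (8400 * eps * D)" using rg m0(2,3) by (intro mult_mono) auto
      finally show ?thesis by simp
    qed
    have t3: "- Re (cnj g0 * ru) \<le> 7560 * eps * D"
    proof -
      have "- Re (cnj g0 * ru) \<le> norm (cnj g0 * ru)" using abs_Re_le_cmod[of "cnj g0 * ru"] by linarith
      also have "\<dots> \<le> (840 * eps) * (9 * D)"
        unfolding norm_mult complex_mod_cnj using g0 ru eps_pos by (intro mult_mono) auto
      finally show ?thesis by simp
    qed
    have t4: "- Re (cnj g0 * rg) \<le> 7056000 * eps * eps * D"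
    proof -
      have "- Re (cnj g0 * rg) \<le> norm (cnj g0 * rg)" using abs_Re_le_cmod[of "cnj g0 * rg"] by linarith
      also have "\<dots> \<le> (840 * eps) * (8400 * eps * D)"
        unfolding norm_mult complex_mod_cnj using g0 rg eps_pos by (intro mult_mono) auto
      finally show ?thesis by simp
    qed
    have "Re (cnj (of_real \<sigma> * u0 - g0) * (U + G)) =
      \<sigma> * Re (cnj u0 * U) + Re (of_real \<sigma> * cnj u0 * rg) - Re (cnj g0 * ru) - Re (cnj g0 * rg)"
      by (rule normal_component_expansion[OF Re(2)]) (simp_all add: ru_def rg_def)
    also have "\<dots> \<le> - D / 21600 + 25200 * eps * D + 7560 * eps * D + 7056000 * eps * eps * D"
      using t1 t2 t3 t4 by linarith
    also have "\<dots> = (- 1 / 21600 + 25200 * eps + 7560 * eps + 7056000 * eps * eps) * D"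
      by (simp add: algebra_simps)
    also have "\<dots> < 0" using D by (intro mult_neg_pos) (simp_all add: eps_def)
    finally have "Re (cnj (of_real \<sigma> * u0 - g0) * (hor z - hor z0)) < 0"
      by (simp add: hor U_def G_def algebra_simps)
    then show ?thesis by (simp add: inner_complex_def algebra_simps)
  qed
  then show ?thesis by blast
qed

lemma outer_boundary_strictly_convex: "strictly_convex_curve (surf ` sphere 0 4)"
proof -
  have lv: "(1::real) \<le> 4" "(4::real) \<le> 4" "(4::real) \<noteq> 2" by auto
  note cur = level_curve(2-4)[OF lv]
  have "open_segment x y \<subseteq> inside (hproj ` surf ` sphere 0 4)"
    if "x \<in> closure (inside (hproj ` surf ` sphere 0 4))" "y \<in> closure (inside (hproj ` surf ` sphere 0 4))"
      "x \<noteq> y" for x y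
    using that unfolding cur(3)[symmetric]
  proof (rule inside_closed_curve_with_strict_supports[OF cur(1,2), rotated])
    fix a assume "a \<in> path_image ((\<lambda>z. of_real scal * hor z) \<circ> circlepath 0 4)"
    then obtain z0 where z0: "norm z0 = 4" "a = of_real scal * hor z0"
      unfolding cur(3) by (auto simp: surf_def)
    obtain n where n: "\<And>z. norm z = 4 \<Longrightarrow> z \<noteq> z0 \<Longrightarrow> n \<bullet> hor z < n \<bullet> hor z0"
      using outer_support[OF z0(1)] by blast
    show "\<exists>n. \<forall>b\<in>path_image ((\<lambda>z. of_real scal * hor z) \<circ> circlepath 0 4) - {a}. n \<bullet> b < n \<bullet> a"
    proof (intro exI ballI)
      fix b assume "b \<in> path_image ((\<lambda>z. of_real scal * hor z) \<circ> circlepath 0 4) - {a}"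
      then obtain z where z: "norm z = 4" "b = of_real scal * hor z" and "b \<noteq> a"
        unfolding cur(3) by (auto simp: surf_def)
      then have "z \<noteq> z0" by (auto simp: z0(2))
      then show "n \<bullet> b < n \<bullet> a"
        using n[of z] z scal_pos by (simp add: z0(2) scaleR_conv_of_real[symmetric])
    qed
  qed
  then show ?thesis by (simp add: strictly_convex_curve_def enclosed_def)
qed

section \<open>Analyticity of the outer boundary\<close>

lemma sums_pt: "f sums a \<Longrightarrow> g sums b \<Longrightarrow> (\<lambda>n. pt (f n) (g n)) sums pt a b"
  unfolding pt_linear_combination by (intro sums_add sums_scaleR_left sums_Re sums_Im)

lemma real_analytic_horizontal:
  assumes hol: "f holomorphic_on S" and S: "open S" and sub: "\<And>t. of_real t \<in> S"
  shows "real_analytic (\<lambda>t. pt (f (of_real t)) c)"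
  unfolding real_analytic_def
proof
  fix s :: real
  obtain e where e: "e > 0" "ball (of_real s) e \<subseteq> S" using S sub open_contains_ball by blast
  define k where "k n = (deriv ^^ n) f (of_real s) / fact n" for n
  define a where "a n = pt (k n) (if n = 0 then c else 0)" for n :: nat
  have "(\<lambda>n. (t - s) ^ n *\<^sub>R a n) sums pt (f (of_real t)) c" if t: "\<bar>t - s\<bar> < e" for t
  proof -
    have "of_real t \<in> ball (of_real s :: complex) e"
      using t by (simp add: dist_norm flip: of_real_diff) 
    then have "(\<lambda>n. k n * (of_real t - of_real s) ^ n) sums f (of_real t)"
      unfolding k_def using e by (intro holomorphic_power_series holomorphic_on_subset[OF hol])
    moreover have "(\<lambda>n. if n = 0 then c else 0) sums c"
      using sums_single[of 0 "\<lambda>_. c"] by simp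
    ultimately have "(\<lambda>n. pt (k n * (of_real t - of_real s) ^ n) (if n = 0 then c else 0)) sums pt (f (of_real t)) c"
      by (rule sums_pt)
    moreover have "pt (k n * (of_real t - of_real s) ^ n) (if n = 0 then c else 0) = (t - s) ^ n *\<^sub>R a n" for n
      by (simp add: a_def vec_eq_iff forall_3 flip: of_real_diff of_real_power) 
    ultimately show ?thesis by simp
  qed
  then show "\<exists>\<epsilon>>0. \<exists>a. \<forall>t. \<bar>t - s\<bar> < \<epsilon> \<longrightarrow> (\<lambda>n. (t - s) ^ n *\<^sub>R a n) sums pt (f (of_real t)) c"
    using e(1) by blast
qed

text \<open>On \<open>norm z = 4\<close> the reflection \<open>s \<mapsto> - cnj s\<close> agrees with the holomorphic map
  \<open>s \<mapsto> s - 2 * ln 4\<close>. With \<open>s = ln 4 + 2 * pi * \<i> * \<tau>\<close> the boundary curve therefore extends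
  holomorphically to complex \<open>\<tau>\<close>.\<close>

lemma outer_boundary_analytic: "analytic_jordan_curve_in (- 1) (surf ` sphere 0 4)"
proof -
  define ex :: "complex \<Rightarrow> complex" where "ex \<tau> = of_real (ln 4) + 2 * of_real pi * \<i> * \<tau>" for \<tau>
  define S where "S = ex -` (strip \<inter> (\<lambda>s. s - of_real (2 * ln 4)) -` strip \<inter> exp -` (- {2}))"
  define f where "f \<tau> = of_real scal * (mob (exp (ex \<tau>)) + (prim (ex \<tau>) - prim (ex \<tau> - of_real (2 * ln 4))))" for \<tau>
  define c where "c t = exp (ex (of_real t))" for t :: real
  have cont: "continuous_on UNIV ex" unfolding ex_def by (intro continuous_intros)
  have S: "open S"
    unfolding S_def
    by (intro open_vimage open_Int open_strip continuous_intros cont) auto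
  have hp: "prim holomorphic_on strip"
    using has_field_derivative_prim open_strip by (auto simp: holomorphic_on_open)
  have hex: "ex holomorphic_on A" for A unfolding ex_def by (intro holomorphic_intros)
  have "(prim \<circ> ex) holomorphic_on S" "(prim \<circ> (\<lambda>\<tau>. ex \<tau> - of_real (2 * ln 4))) holomorphic_on S"
    by (rule holomorphic_on_compose_gen[OF _ hp]; auto intro!: holomorphic_intros hex simp: S_def)+
  then have hol: "f holomorphic_on S"
    unfolding f_def mob_def by (auto intro!: holomorphic_intros hex simp: S_def o_def)
  have nc: "norm (c t) = 4" for t by (simp add: c_def ex_def)
  have Re: "Re (ex (of_real t)) = ln 4" for t by (simp add: ex_def)
  have str: "ex (of_real t) \<in> strip" "ex (of_real t) - of_real (2 * ln 4) \<in> strip" for t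
    using Re[of t] ln_numerals(1,2,4) unfolding strip_def mem_Collect_eq minus_complex.sel Re_complex_of_real
    by linarith+
  have c2: "c t \<noteq> 2" for t using nc[of t] by auto
  have sub: "of_real t \<in> S" for t
    using str[of t] c2[of t] by (simp add: S_def c_def)
  have refl: "- cnj (ex (of_real t)) = ex (of_real t) - of_real (2 * ln 4)" for t
    by (simp add: complex_eq_iff ex_def)
  have sc: "surf (c t) = pt (f (of_real t)) (- 1)" for t
    unfolding surf_outer[OF nc] using hor_exp[OF str(1)[of t]]
    by (simp add: f_def c_def corr_def refl)
  have per: "c (t + 1) = c t" for t
    by (simp add: c_def ex_def exp_add ring_distribs flip: add.assoc)
  have inj: "inj_on c {0..<1}"
  proof (rule inj_onI)
    fix s t assume st: "s \<in> {0..<1}" "t \<in> {0..<1}" "c s = c t"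
    then obtain n :: int where "ex (of_real s) = ex (of_real t) + (of_int (2 * n) * pi) * \<i>"
      unfolding c_def exp_eq by blast
    then have "Im (ex (of_real s)) = Im (ex (of_real t) + (of_int (2 * n) * pi) * \<i>)" by simp
    then have "pi * s = pi * (t + of_int n)" by (simp add: ex_def algebra_simps)
    then have n: "s = t + of_int n" using pi_gt_zero by simp
    then have "real_of_int n < 1" "real_of_int n > - 1" using st by auto
    then have "n = 0" by linarith
    then show "s = t" using n by simp
  qed
  have im: "range c = sphere 0 4"
  proof (intro equalityI subsetI)
    fix z :: complex assume "z \<in> sphere 0 4"
    then have z: "norm z = 4" "z \<noteq> 0" by auto
    have "ex (of_real (Im (Ln z) / (2 * pi))) = Ln z"
      using z by (simp add: complex_eq_iff ex_def)
    then show "z \<in> range c" using z by (auto simp: c_def intro!: range_eqI[of _ _ "Im (Ln z) / (2 * pi)"])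
  qed (use nc in auto)
  have dc: "(c has_vector_derivative 2 * of_real pi * \<i> * c t) (at t)" for t
    unfolding c_def ex_def
    by (rule has_vector_derivative_real_field) (auto intro!: derivative_eq_intros)
  have vd: "vector_derivative (\<lambda>t. surf (c t)) (at t) \<noteq> 0" for t
  proof -
    have cc: "c t \<in> collar - {2}" using nc[of t] by (auto simp: collar_def)
    define v where "v = 2 * of_real pi * \<i> * c t"
    have "v \<noteq> 0" using nc[of t] by (auto simp: v_def)
    have diff: "(surf has_derivative (\<lambda>v. dder v surf (c t))) (at (c t))"
    proof -
      have "surf differentiable (at (c t))"
        using surf_data cc unfolding weierstrass_data_def differentiable_def by blast
      then show ?thesis unfolding dder_def using frechet_derivative_works by blast
    qed
    have "((\<lambda>t. surf (c t)) has_derivative (\<lambda>x. dder (x *\<^sub>R v) surf (c t))) (at t)"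
      using has_derivative_compose[OF dc[of t, unfolded has_vector_derivative_def] diff]
      by (simp add: v_def)
    moreover have "dder (x *\<^sub>R v) surf (c t) = x *\<^sub>R dder v surf (c t)" for x
      using linear_scale[OF bounded_linear.linear[OF has_derivative_bounded_linear[OF diff]]] by blast
    ultimately have "((\<lambda>t. surf (c t)) has_vector_derivative dder v surf (c t)) (at t)"
      by (simp add: has_vector_derivative_def)
    then have "vector_derivative (\<lambda>t. surf (c t)) (at t) = dder v surf (c t)"
      by (rule vector_derivative_at)
    moreover have "spacelike_at surf (c t)"
      using surf_maximal[of "{c t}"] cc by (simp add: maximal_surface_def)
    then have "dder v surf (c t) \<noteq> 0"
      using \<open>v \<noteq> 0\<close> by (auto simp: spacelike_at_def lorentz_def)
    ultimately show ?thesis by simp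
  qed
  show ?thesis
    unfolding analytic_jordan_curve_in_def
  proof (intro conjI exI allI)
    show "surf ` sphere 0 4 \<subseteq> hplane (- 1)" by (auto simp: hplane_def surf_outer)
    show "real_analytic (\<lambda>t. surf (c t))"
      unfolding sc using hol S sub by (rule real_analytic_horizontal)
    show "surf (c (s + 1)) = surf (c s)" for s by (simp add: per)
    have "inj_on surf (sphere 0 4)"
      by (rule inj_on_subset[OF inj_on_surf]) auto
    then show "inj_on (\<lambda>t. surf (c t)) {0..<1}"
      using inj im unfolding inj_on_def by (metis rangeI)
    show "vector_derivative (\<lambda>t. surf (c t)) (at s) \<noteq> 0" for s by (rule vd)
    show "range (\<lambda>t. surf (c t)) = surf ` sphere 0 4" by (simp add: im[symmetric] image_image)
  qed
qed

section \<open>Existence of the annulus\<close>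

theorem theorem3:
  shows "\<exists>r R p X. maximal_annulus_planar_end (-1) 1 r R p X \<and>
    inj_on X (sphere 0 r \<union> sphere 0 R) \<and>
    (let A = X ` punctured_annulus r R p;
         bA = X ` (sphere 0 r \<union> sphere 0 R)
     in circle_in 1 (bA \<inter> hplane 1) \<and>
        analytic_jordan_curve_in (-1) (bA \<inter> hplane (-1)) \<and>
        strictly_convex_curve (bA \<inter> hplane (-1)) \<and>
        \<not> circle_in (-1) (bA \<inter> hplane (-1)) \<and>
        (\<exists>t0. -1 < t0 \<and> t0 < 1 \<and>
           jordan_curve_in t0 (A \<inter> hplane t0) \<and> \<not> convex_curve (A \<inter> hplane t0)))"
proof -
  obtain \<rho> where \<rho>: "1 < \<rho>" "\<rho> < 2" and nonconvex: "\<not> convex_curve (surf ` sphere 0 \<rho>)"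
    using nonconvex_level by blast
  define t0 where "t0 = 1 - ln \<rho> / ln 2"
  have lv: "1 \<le> \<rho>" "\<rho> \<le> 4" "\<rho> \<noteq> 2" using \<rho> by auto
  have "0 < ln \<rho>" "ln \<rho> < ln 2" using \<rho> by simp_all
  then have t0: "- 1 < t0" "t0 < 1" using ln_numerals(2) by (simp_all add: t0_def field_simps)
  have level: "\<exists>t0. -1 < t0 \<and> t0 < 1 \<and> jordan_curve_in t0 (surf ` punctured_annulus 1 4 2 \<inter> hplane t0) \<and>
      \<not> convex_curve (surf ` punctured_annulus 1 4 2 \<inter> hplane t0)"
    using t0 level_set[OF lv] level_curve(1)[OF lv] nonconvex
    by (intro exI[of _ t0]) (simp add: t0_def)
  have "inj_on surf (sphere 0 1 \<union> sphere 0 4)"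
    by (rule inj_on_subset[OF inj_on_surf]) auto
  then show ?thesis
    using surf_annulus level inner_boundary_circle outer_boundary_analytic
      outer_boundary_strictly_convex outer_boundary_not_circle
    unfolding Let_def
    by (rule_tac x = 1 in exI, rule_tac x = 4 in exI, rule_tac x = 2 in exI, rule_tac x = surf in exI)
      (simp only: boundary_in_planes simp_thms)
qed

end
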